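(* Let $\mathbb K$ be a field and let $R$, $B$, $C$ be finite-dimensional $\mathbb K$-algebras, with $R$ of finite global dimension. Let $\mathcal R$ be a recollement of $\mathcal D=\mathcal D^b(R)$ by $\mathcal X=\mathcal D^b(C)$ and $\mathcal Y=\mathcal D^b(B)$, with functors $i^*,i_*,i^!,j_!,j^*,j_*$. Let $X$ and $Y$ be tilting objects of $\mathcal X$ and $\mathcal Y$, respectively, and let $Z=i_*Y\oplus K_X$ be the silting object of $\mathcal D$ glued from $X$ and $Y$ with respect to $\mathcal R$. Then $Z$ is tilting in $\mathcal D$ if and only if the following conditions are satisfied: (a) $\mathrm{Hom}_{\mathcal Y}(Y,i^*j_*X[k])=0$ for all $k<-1$; (b) $\mathrm{Hom}_{\mathcal Y}(i^*j_*X,Y[k])=0$ for all $k<0$; (c) $\mathrm{Hom}_{\mathcal Y}(i^*j_*X,i^*j_*X[k])=0$ for all $k<-1$.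
   Context: $\mathcal D^b(A)$ denotes the bounded derived category of finitely generated right $A$-modules. A recollement of a triangulated category $\mathcal D$ by triangulated categories $\mathcal X$ and $\mathcal Y$ consists of six triangle functors $i^*,i^!:\mathcal D\to\mathcal Y$, $i_*:\mathcal Y\to\mathcal D$, $j^*:\mathcal D\to\mathcal X$, $j_!,j_*:\mathcal X\to\mathcal D$ such that: (1) $(i^*,i_* )$, $(i_*,i^!)$, $(j_!,j^* )$, $(j^*,j_* )$ are adjoint pairs; (2) $i_*,j_*,j_!$ are fully faithful; (3) $i^!j_*=0$; (4) for each $Z\in\mathcal D$ the units and counits of the adjunctions yield triangles $i_*i^!Z\to Z\to j_*j^*Z\to i_*i^!Z[1]$ and $j_!j^*Z\to Z\to i_*i^*Z\to j_!j^*Z[1]$. An object $M$ of a triangulated category $\mathcal D$ is silting if $\mathrm{Hom}_{\mathcal D}(M,M[i])=0$ for all $i>0$ and $\mathcal D$ is the smallest triangulated subcategory containing $M$ and closed under direct summands, extensions and shifts; it is tilting if in addition $\mathrm{Hom}_{\mathcal D}(M,M[i])=0$ for all $i<0$. The co-t-structure $(\mathcal Y_{\geq 0},\mathcal Y_{\leq 0})$ associated with a silting object $Y$ of $\mathcal Y$: $\mathcal Y_{\geq 0}$ (resp. $\mathcal Y_{\leq 0}$) is the smallest full subcategory closed under direct summands, direct sums and extensions containing $\{Y[i]:i\leq 0\}$ (resp. $\{Y[i]:i\geq 0\}$). Put $\mathcal Y_{\geq n}=\mathcal Y_{\geq 0}[-n]$, $\mathcal Y_{\leq n}=\mathcal Y_{\leq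 0}[-n]$. Every $W\in\mathcal Y$ lies in a (non-functorial) truncation triangle $\beta_{\geq 1}W\to W\to\beta_{\leq 0}W\to(\beta_{\geq 1}W)[1]$ with $\beta_{\geq 1}W\in\mathcal Y_{\geq 1}$, $\beta_{\leq 0}W\in\mathcal Y_{\leq 0}$. For silting objects $X\in\mathcal X$, $Y\in\mathcal Y$, the silting object of $\mathcal D$ glued from $X$ and $Y$ with respect to $\mathcal R$ is $Z=i_*Y\oplus K_X$, where $K_X$ is defined by the triangle $i_*\beta_{\geq 1}i^!j_!X\to j_!X\to K_X\to(i_*\beta_{\geq 1}i^!j_!X)[1]$; here $\beta_{\geq 1}i^!j_!X\to i^!j_!X$ is a choice of truncation for the co-t-structure associated with $Y$, and the first morphism of the triangle corresponds to it under the adjunction $(i_*,i^!)$. (The object $Z$ is always silting in $\mathcal D$.) *)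

theory Defs
  imports "HOL-Algebra.Module" "HOL-Algebra.AbelCoset"
begin

section \<open>Triangulated categories\<close>

text \<open>
  The shift is a strict action of the integers: \<open>Sh T n X\<close> is \<open>X[n]\<close> and \<open>Shm T n f\<close> is \<open>f[n]\<close>.
  \<open>Zer T X Y\<close> and \<open>Pls T\<close> are the zero and the addition of the Hom groups.
\<close>

record ('o, 'm) shift_cat =
  Obj :: "'o set"
  Hom :: "'o \<Rightarrow> 'o \<Rightarrow> 'm set"
  Idm :: "'o \<Rightarrow> 'm"
  Cmp :: "'m \<Rightarrow> 'm \<Rightarrow> 'm" (infixr "\<cdot>\<index>" 70)
  Zer :: "'o \<Rightarrow> 'o \<Rightarrow> 'm"
  Pls :: "'m \<Rightarrow> 'm \<Rightarrow> 'm"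
  Sh  :: "int \<Rightarrow> 'o \<Rightarrow> 'o"
  Shm :: "int \<Rightarrow> 'm \<Rightarrow> 'm"

text \<open>\<open>(X, Y, Z, f, g, h)\<close> stands for the triangle \<open>X \<rightarrow> Y \<rightarrow> Z \<rightarrow> X[1]\<close>.\<close>

type_synonym ('o, 'm) triangle = "'o \<times> 'o \<times> 'o \<times> 'm \<times> 'm \<times> 'm"

record ('o, 'm) tri_cat = "('o, 'm) shift_cat" +
  Tri :: "('o, 'm) triangle set"

definition hom_group :: "('o, 'm, 'z) shift_cat_scheme \<Rightarrow> 'o \<Rightarrow> 'o \<Rightarrow> 'm monoid" where
  "hom_group T X Y = \<lparr>carrier = Hom T X Y, monoid.mult = Pls T, one = Zer T X Y\<rparr>"

definition neg :: "('o, 'm, 'z) shift_cat_scheme \<Rightarrow> 'o \<Rightarrow> 'o \<Rightarrow> 'm \<Rightarrow> 'm" where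
  "neg T X Y f = m_inv (hom_group T X Y) f"

definition is_iso :: "('o, 'm, 'z) shift_cat_scheme \<Rightarrow> 'o \<Rightarrow> 'o \<Rightarrow> 'm \<Rightarrow> bool" where
  "is_iso T X Y f \<longleftrightarrow> f \<in> Hom T X Y \<and>
     (\<exists>g\<in>Hom T Y X. g \<cdot>\<^bsub>T\<^esub> f = Idm T X \<and> f \<cdot>\<^bsub>T\<^esub> g = Idm T Y)"

definition is_zero :: "('o, 'm, 'z) shift_cat_scheme \<Rightarrow> 'o \<Rightarrow> bool" where
  "is_zero T X \<longleftrightarrow> X \<in> Obj T \<and> Idm T X = Zer T X X"

definition is_dsum :: "('o, 'm, 'z) shift_cat_scheme \<Rightarrow> 'o \<Rightarrow> 'o \<Rightarrow> 'o \<Rightarrow> bool" where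
  "is_dsum T S X Y \<longleftrightarrow> S \<in> Obj T \<and> X \<in> Obj T \<and> Y \<in> Obj T \<and>
     (\<exists>a\<in>Hom T X S. \<exists>b\<in>Hom T Y S. \<exists>p\<in>Hom T S X. \<exists>q\<in>Hom T S Y.
        p \<cdot>\<^bsub>T\<^esub> a = Idm T X \<and> q \<cdot>\<^bsub>T\<^esub> b = Idm T Y \<and>
        q \<cdot>\<^bsub>T\<^esub> a = Zer T X Y \<and> p \<cdot>\<^bsub>T\<^esub> b = Zer T Y X \<and>
        Pls T (a \<cdot>\<^bsub>T\<^esub> p) (b \<cdot>\<^bsub>T\<^esub> q) = Idm T S)"

definition is_triangle :: "('o, 'm, 'z) shift_cat_scheme \<Rightarrow> ('o, 'm) triangle \<Rightarrow> bool" where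
  "is_triangle T = (\<lambda>(X, Y, Z, f, g, h).
     X \<in> Obj T \<and> Y \<in> Obj T \<and> Z \<in> Obj T \<and>
     f \<in> Hom T X Y \<and> g \<in> Hom T Y Z \<and> h \<in> Hom T Z (Sh T 1 X))"

definition triangle_mor ::
  "('o, 'm, 'z) shift_cat_scheme \<Rightarrow> ('o, 'm) triangle \<Rightarrow> ('o, 'm) triangle \<Rightarrow> 'm \<Rightarrow> 'm \<Rightarrow> 'm \<Rightarrow> bool" where
  "triangle_mor T = (\<lambda>(X, Y, Z, f, g, h) (X', Y', Z', f', g', h') a b c.
     a \<in> Hom T X X' \<and> b \<in> Hom T Y Y' \<and> c \<in> Hom T Z Z' \<and>
     b \<cdot>\<^bsub>T\<^esub> f = f' \<cdot>\<^bsub>T\<^esub> a \<and> c \<cdot>\<^bsub>T\<^esub> g = g' \<cdot>\<^bsub>T\<^esub> b \<and> Shm T 1 a \<cdot>\<^bsub>T\<^esub> h = h' \<cdot>\<^bsub>T\<^esub> c)"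

definition triangle_iso ::
  "('o, 'm, 'z) shift_cat_scheme \<Rightarrow> ('o, 'm) triangle \<Rightarrow> ('o, 'm) triangle \<Rightarrow> bool" where
  "triangle_iso T = (\<lambda>(X, Y, Z, f, g, h) (X', Y', Z', f', g', h').
     \<exists>a b c. is_iso T X X' a \<and> is_iso T Y Y' b \<and> is_iso T Z Z' c \<and>
       triangle_mor T (X, Y, Z, f, g, h) (X', Y', Z', f', g', h') a b c)"

locale additive_category =
  fixes T :: "('o, 'm, 'z) shift_cat_scheme" (structure)
  assumes Hom_disjoint: "\<lbrakk>f \<in> Hom T X Y; f \<in> Hom T X' Y'; X \<in> Obj T; Y \<in> Obj T; X' \<in> Obj T; Y' \<in> Obj T\<rbrakk>
      \<Longrightarrow> X = X' \<and> Y = Y'"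
    and Idm_in: "X \<in> Obj T \<Longrightarrow> Idm T X \<in> Hom T X X"
    and Cmp_in: "\<lbrakk>X \<in> Obj T; Y \<in> Obj T; Z \<in> Obj T; f \<in> Hom T X Y; g \<in> Hom T Y Z\<rbrakk> \<Longrightarrow> g \<cdot> f \<in> Hom T X Z"
    and Cmp_Idm: "\<lbrakk>X \<in> Obj T; Y \<in> Obj T; f \<in> Hom T X Y\<rbrakk> \<Longrightarrow> f \<cdot> Idm T X = f"
    and Idm_Cmp: "\<lbrakk>X \<in> Obj T; Y \<in> Obj T; f \<in> Hom T X Y\<rbrakk> \<Longrightarrow> Idm T Y \<cdot> f = f"
    and Cmp_assoc: "\<lbrakk>W \<in> Obj T; X \<in> Obj T; Y \<in> Obj T; Z \<in> Obj T;
        f \<in> Hom T W X; g \<in> Hom T X Y; h \<in> Hom T Y Z\<rbrakk> \<Longrightarrow> (h \<cdot> g) \<cdot> f = h \<cdot> (g \<cdot> f)"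
    and Hom_group: "\<lbrakk>X \<in> Obj T; Y \<in> Obj T\<rbrakk> \<Longrightarrow> comm_group (hom_group T X Y)"
    and Cmp_Pls: "\<lbrakk>X \<in> Obj T; Y \<in> Obj T; Z \<in> Obj T; f \<in> Hom T X Y; f' \<in> Hom T X Y; g \<in> Hom T Y Z\<rbrakk>
        \<Longrightarrow> g \<cdot> Pls T f f' = Pls T (g \<cdot> f) (g \<cdot> f')"
    and Pls_Cmp: "\<lbrakk>X \<in> Obj T; Y \<in> Obj T; Z \<in> Obj T; f \<in> Hom T X Y; g \<in> Hom T Y Z; g' \<in> Hom T Y Z\<rbrakk>
        \<Longrightarrow> Pls T g g' \<cdot> f = Pls T (g \<cdot> f) (g' \<cdot> f)"
    and zero_ex: "\<exists>X. is_zero T X"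
    and dsum_ex: "\<lbrakk>X \<in> Obj T; Y \<in> Obj T\<rbrakk> \<Longrightarrow> \<exists>S. is_dsum T S X Y"

locale additive_shift_category = additive_category +
  assumes Sh_in: "X \<in> Obj T \<Longrightarrow> Sh T n X \<in> Obj T"
    and Shm_in: "\<lbrakk>X \<in> Obj T; Y \<in> Obj T; f \<in> Hom T X Y\<rbrakk> \<Longrightarrow> Shm T n f \<in> Hom T (Sh T n X) (Sh T n Y)"
    and Shm_Idm: "X \<in> Obj T \<Longrightarrow> Shm T n (Idm T X) = Idm T (Sh T n X)"
    and Shm_Cmp: "\<lbrakk>X \<in> Obj T; Y \<in> Obj T; Z \<in> Obj T; f \<in> Hom T X Y; g \<in> Hom T Y Z\<rbrakk>
        \<Longrightarrow> Shm T n (g \<cdot> f) = Shm T n g \<cdot> Shm T n f"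
    and Shm_Pls: "\<lbrakk>X \<in> Obj T; Y \<in> Obj T; f \<in> Hom T X Y; g \<in> Hom T X Y\<rbrakk>
        \<Longrightarrow> Shm T n (Pls T f g) = Pls T (Shm T n f) (Shm T n g)"
    and Sh_0: "X \<in> Obj T \<Longrightarrow> Sh T 0 X = X"
    and Sh_add: "X \<in> Obj T \<Longrightarrow> Sh T (m + n) X = Sh T m (Sh T n X)"
    and Shm_0: "\<lbrakk>X \<in> Obj T; Y \<in> Obj T; f \<in> Hom T X Y\<rbrakk> \<Longrightarrow> Shm T 0 f = f"
    and Shm_add: "\<lbrakk>X \<in> Obj T; Y \<in> Obj T; f \<in> Hom T X Y\<rbrakk> \<Longrightarrow> Shm T (m + n) f = Shm T m (Shm T n f)"

locale triangulated_category =
  additive_shift_category T for T :: "('o, 'm, 'z) tri_cat_scheme" (structure) +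
  assumes Tri_in: "t \<in> Tri T \<Longrightarrow> is_triangle T t"
    and Tri_iso: "\<lbrakk>t \<in> Tri T; is_triangle T t'; triangle_iso T t t'\<rbrakk> \<Longrightarrow> t' \<in> Tri T"
    and Tri_Idm: "\<lbrakk>X \<in> Obj T; is_zero T N\<rbrakk> \<Longrightarrow> (X, X, N, Idm T X, Zer T X N, Zer T N (Sh T 1 X)) \<in> Tri T"
    and Tri_ex: "\<lbrakk>X \<in> Obj T; Y \<in> Obj T; f \<in> Hom T X Y\<rbrakk> \<Longrightarrow> \<exists>Z g h. (X, Y, Z, f, g, h) \<in> Tri T"
    and Tri_rotate: "is_triangle T (X, Y, Z, f, g, h) \<Longrightarrow>
        (X, Y, Z, f, g, h) \<in> Tri T \<longleftrightarrow>
        (Y, Z, Sh T 1 X, g, h, neg T (Sh T 1 X) (Sh T 1 Y) (Shm T 1 f)) \<in> Tri T"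
    and Tri_mor: "\<lbrakk>(X, Y, Z, f, g, h) \<in> Tri T; (X', Y', Z', f', g', h') \<in> Tri T;
        a \<in> Hom T X X'; b \<in> Hom T Y Y'; b \<cdot> f = f' \<cdot> a\<rbrakk> \<Longrightarrow>
        \<exists>c. triangle_mor T (X, Y, Z, f, g, h) (X', Y', Z', f', g', h') a b c"
    and octahedral: "\<lbrakk>(X, Y, Z', f, f1, f2) \<in> Tri T; (Y, Z, X', g, g1, g2) \<in> Tri T;
        (X, Z, Y', g \<cdot> f, h1, h2) \<in> Tri T\<rbrakk> \<Longrightarrow>
        \<exists>u v. (Z', Y', X', u, v, Shm T 1 f1 \<cdot> g2) \<in> Tri T \<and>
          u \<cdot> f1 = h1 \<cdot> g \<and> h2 \<cdot> u = f2 \<and> v \<cdot> h1 = g1 \<and> g2 \<cdot> v = Shm T 1 f \<cdot> h2"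

section \<open>Triangle functors, adjunctions, recollements\<close>

text \<open>\<open>FSh F X\<close> is the isomorphism \<open>F (X[1]) \<rightarrow> (F X)[1]\<close> that belongs to a triangle functor.\<close>

record ('o, 'm, 'p, 'n) tri_fun =
  FOb :: "'o \<Rightarrow> 'p"
  FMor :: "'m \<Rightarrow> 'n"
  FSh :: "'o \<Rightarrow> 'n"

locale triangle_functor =
  fixes S :: "('o, 'm) tri_cat" and T :: "('p, 'n) tri_cat" and F :: "('o, 'm, 'p, 'n) tri_fun"
  assumes FOb_in: "X \<in> Obj S \<Longrightarrow> FOb F X \<in> Obj T"
    and FMor_in: "\<lbrakk>X \<in> Obj S; Y \<in> Obj S; f \<in> Hom S X Y\<rbrakk> \<Longrightarrow> FMor F f \<in> Hom T (FOb F X) (FOb F Y)"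
    and FMor_Idm: "X \<in> Obj S \<Longrightarrow> FMor F (Idm S X) = Idm T (FOb F X)"
    and FMor_Cmp: "\<lbrakk>X \<in> Obj S; Y \<in> Obj S; Z \<in> Obj S; f \<in> Hom S X Y; g \<in> Hom S Y Z\<rbrakk>
        \<Longrightarrow> FMor F (g \<cdot>\<^bsub>S\<^esub> f) = FMor F g \<cdot>\<^bsub>T\<^esub> FMor F f"
    and FMor_Pls: "\<lbrakk>X \<in> Obj S; Y \<in> Obj S; f \<in> Hom S X Y; g \<in> Hom S X Y\<rbrakk>
        \<Longrightarrow> FMor F (Pls S f g) = Pls T (FMor F f) (FMor F g)"
    and FSh_iso: "X \<in> Obj S \<Longrightarrow> is_iso T (FOb F (Sh S 1 X)) (Sh T 1 (FOb F X)) (FSh F X)"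
    and FSh_natural: "\<lbrakk>X \<in> Obj S; Y \<in> Obj S; f \<in> Hom S X Y\<rbrakk>
        \<Longrightarrow> FSh F Y \<cdot>\<^bsub>T\<^esub> FMor F (Shm S 1 f) = Shm T 1 (FMor F f) \<cdot>\<^bsub>T\<^esub> FSh F X"
    and FTri: "(X, Y, Z, f, g, h) \<in> Tri S \<Longrightarrow>
        (FOb F X, FOb F Y, FOb F Z, FMor F f, FMor F g, FSh F X \<cdot>\<^bsub>T\<^esub> FMor F h) \<in> Tri T"

definition fully_faithful :: "('o, 'm) tri_cat \<Rightarrow> ('p, 'n) tri_cat \<Rightarrow> ('o, 'm, 'p, 'n) tri_fun \<Rightarrow> bool" where
  "fully_faithful S T F \<longleftrightarrow> (\<forall>X\<in>Obj S. \<forall>Y\<in>Obj S.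
     bij_betw (FMor F) (Hom S X Y) (Hom T (FOb F X) (FOb F Y)))"

text \<open>\<open>F : S \<rightarrow> T\<close> is left adjoint to \<open>G : T \<rightarrow> S\<close> with unit \<open>\<eta>\<close> and counit \<open>\<epsilon>\<close>.\<close>

locale adjoint_pair =
  fixes S :: "('o, 'm) tri_cat" and T :: "('p, 'n) tri_cat"
    and F :: "('o, 'm, 'p, 'n) tri_fun" and G :: "('p, 'n, 'o, 'm) tri_fun"
    and \<eta> :: "'o \<Rightarrow> 'm" and \<epsilon> :: "'p \<Rightarrow> 'n"
  assumes unit_in: "X \<in> Obj S \<Longrightarrow> \<eta> X \<in> Hom S X (FOb G (FOb F X))"
    and unit_natural: "\<lbrakk>X \<in> Obj S; Y \<in> Obj S; f \<in> Hom S X Y\<rbrakk>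
        \<Longrightarrow> \<eta> Y \<cdot>\<^bsub>S\<^esub> f = FMor G (FMor F f) \<cdot>\<^bsub>S\<^esub> \<eta> X"
    and counit_in: "U \<in> Obj T \<Longrightarrow> \<epsilon> U \<in> Hom T (FOb F (FOb G U)) U"
    and counit_natural: "\<lbrakk>U \<in> Obj T; V \<in> Obj T; g \<in> Hom T U V\<rbrakk>
        \<Longrightarrow> g \<cdot>\<^bsub>T\<^esub> \<epsilon> U = \<epsilon> V \<cdot>\<^bsub>T\<^esub> FMor F (FMor G g)"
    and counit_unit: "X \<in> Obj S \<Longrightarrow> \<epsilon> (FOb F X) \<cdot>\<^bsub>T\<^esub> FMor F (\<eta> X) = Idm T (FOb F X)"
    and unit_counit: "U \<in> Obj T \<Longrightarrow> FMor G (\<epsilon> U) \<cdot>\<^bsub>S\<^esub> \<eta> (FOb G U) = Idm S (FOb G U)"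

text \<open>
  The functors \<open>i\<^sup>*\<close>, \<open>i\<^sub>*\<close>, \<open>i\<^sup>!\<close>, \<open>j\<^sub>!\<close>, \<open>j\<^sup>*\<close>, \<open>j\<^sub>*\<close> in this order, then the units and counits of the
  adjoint pairs \<open>(i\<^sup>*, i\<^sub>*)\<close>, \<open>(i\<^sub>*, i\<^sup>!)\<close>, \<open>(j\<^sub>!, j\<^sup>*)\<close>, \<open>(j\<^sup>*, j\<^sub>*)\<close>.
\<close>

record ('d, 'dm, 'x, 'xm, 'y, 'ym) recollement_data =
  i_pull :: "('d, 'dm, 'y, 'ym) tri_fun"
  i_push :: "('y, 'ym, 'd, 'dm) tri_fun"
  i_shriek :: "('d, 'dm, 'y, 'ym) tri_fun"
  j_shriek :: "('x, 'xm, 'd, 'dm) tri_fun"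
  j_pull :: "('d, 'dm, 'x, 'xm) tri_fun"
  j_push :: "('x, 'xm, 'd, 'dm) tri_fun"
  unit_i_pull_push :: "'d \<Rightarrow> 'dm"
  counit_i_pull_push :: "'y \<Rightarrow> 'ym"
  unit_i_push_shriek :: "'y \<Rightarrow> 'ym"
  counit_i_push_shriek :: "'d \<Rightarrow> 'dm"
  unit_j_shriek_pull :: "'x \<Rightarrow> 'xm"
  counit_j_shriek_pull :: "'d \<Rightarrow> 'dm"
  unit_j_pull_push :: "'d \<Rightarrow> 'dm"
  counit_j_pull_push :: "'x \<Rightarrow> 'xm"

locale recollement =
  D: triangulated_category D + X: triangulated_category X + Y: triangulated_category Y
  for D :: "('d, 'dm) tri_cat" and X :: "('x, 'xm) tri_cat" and Y :: "('y, 'ym) tri_cat" +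
  fixes \<R> :: "('d, 'dm, 'x, 'xm, 'y, 'ym) recollement_data"
  assumes i_pull: "triangle_functor D Y (i_pull \<R>)"
    and i_push: "triangle_functor Y D (i_push \<R>)"
    and i_shriek: "triangle_functor D Y (i_shriek \<R>)"
    and j_shriek: "triangle_functor X D (j_shriek \<R>)"
    and j_pull: "triangle_functor D X (j_pull \<R>)"
    and j_push: "triangle_functor X D (j_push \<R>)"
    and adj_i_pull_push: "adjoint_pair D Y (i_pull \<R>) (i_push \<R>)
          (unit_i_pull_push \<R>) (counit_i_pull_push \<R>)"
    and adj_i_push_shriek: "adjoint_pair Y D (i_push \<R>) (i_shriek \<R>)
          (unit_i_push_shriek \<R>) (counit_i_push_shriek \<R>)"
    and adj_j_shriek_pull: "adjoint_pair X D (j_shriek \<R>) (j_pull \<R>)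
          (unit_j_shriek_pull \<R>) (counit_j_shriek_pull \<R>)"
    and adj_j_pull_push: "adjoint_pair D X (j_pull \<R>) (j_push \<R>)
          (unit_j_pull_push \<R>) (counit_j_pull_push \<R>)"
    and ff_i_push: "fully_faithful Y D (i_push \<R>)"
    and ff_j_push: "fully_faithful X D (j_push \<R>)"
    and ff_j_shriek: "fully_faithful X D (j_shriek \<R>)"
    and i_shriek_j_push: "U \<in> Obj X \<Longrightarrow> is_zero Y (FOb (i_shriek \<R>) (FOb (j_push \<R>) U))"
    and triangle_i_j: "Z \<in> Obj D \<Longrightarrow> \<exists>h.
          (FOb (i_push \<R>) (FOb (i_shriek \<R>) Z), Z, FOb (j_push \<R>) (FOb (j_pull \<R>) Z),
           counit_i_push_shriek \<R> Z, unit_j_pull_push \<R> Z, h) \<in> Tri D"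
    and triangle_j_i: "Z \<in> Obj D \<Longrightarrow> \<exists>h.
          (FOb (j_shriek \<R>) (FOb (j_pull \<R>) Z), Z, FOb (i_push \<R>) (FOb (i_pull \<R>) Z),
           counit_j_shriek_pull \<R> Z, unit_i_pull_push \<R> Z, h) \<in> Tri D"

section \<open>Silting objects, co-t-structures, gluing\<close>

text \<open>
  Closure under isomorphisms and under zero objects is part of closure under direct summands
  (a summand being given by any decomposition \<open>U \<cong> V \<oplus> V'\<close>); closure under cones follows
  from extensions and shifts.
\<close>

inductive_set thick :: "('o, 'm) tri_cat \<Rightarrow> 'o \<Rightarrow> 'o set" for T M where
  base: "M \<in> thick T M"
| shift: "U \<in> thick T M \<Longrightarrow> Sh T n U \<in> thick T M"
| ext: "\<lbrakk>(U, V, W, f, g, h) \<in> Tri T; U \<in> thick T M; W \<in> thick T M\<rbrakk> \<Longrightarrow> V \<in> thick T M"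
| summand: "\<lbrakk>U \<in> thick T M; is_dsum T U V V'\<rbrakk> \<Longrightarrow> V \<in> thick T M"

definition Hom_vanishes :: "('o, 'm) tri_cat \<Rightarrow> 'o \<Rightarrow> 'o \<Rightarrow> bool" where
  "Hom_vanishes T U V \<longleftrightarrow> Hom T U V = {Zer T U V}"

definition silting :: "('o, 'm) tri_cat \<Rightarrow> 'o \<Rightarrow> bool" where
  "silting T M \<longleftrightarrow> M \<in> Obj T \<and> (\<forall>i>0. Hom_vanishes T M (Sh T i M)) \<and> thick T M = Obj T"

definition tilting :: "('o, 'm) tri_cat \<Rightarrow> 'o \<Rightarrow> bool" where
  "tilting T M \<longleftrightarrow> silting T M \<and> (\<forall>i<0. Hom_vanishes T M (Sh T i M))"

inductive_set add_ext_closure :: "('o, 'm) tri_cat \<Rightarrow> 'o set \<Rightarrow> 'o set" for T G where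
  base: "U \<in> G \<Longrightarrow> U \<in> add_ext_closure T G"
| summand: "\<lbrakk>U \<in> add_ext_closure T G; is_dsum T U V V'\<rbrakk> \<Longrightarrow> V \<in> add_ext_closure T G"
| dsum: "\<lbrakk>U \<in> add_ext_closure T G; V \<in> add_ext_closure T G; is_dsum T W U V\<rbrakk> \<Longrightarrow> W \<in> add_ext_closure T G"
| ext: "\<lbrakk>(U, V, W, f, g, h) \<in> Tri T; U \<in> add_ext_closure T G; W \<in> add_ext_closure T G\<rbrakk>
    \<Longrightarrow> V \<in> add_ext_closure T G"

text \<open>\<open>co_ge T M n\<close> and \<open>co_le T M n\<close> are the classes \<open>\<Y>\<^sub>\<ge>\<^sub>n\<close> and \<open>\<Y>\<^sub>\<le>\<^sub>n\<close> of the co-t-structure of \<open>M\<close>.\<close>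

definition co_ge :: "('o, 'm) tri_cat \<Rightarrow> 'o \<Rightarrow> int \<Rightarrow> 'o set" where
  "co_ge T M n = Sh T (- n) ` add_ext_closure T {Sh T i M |i. i \<le> 0}"

definition co_le :: "('o, 'm) tri_cat \<Rightarrow> 'o \<Rightarrow> int \<Rightarrow> 'o set" where
  "co_le T M n = Sh T (- n) ` add_ext_closure T {Sh T i M |i. i \<ge> 0}"

text \<open>
  \<open>b : V \<rightarrow> i\<^sup>! j\<^sub>! M\<close> is a choice of the truncation \<open>\<beta>\<^sub>\<ge>\<^sub>1 i\<^sup>! j\<^sub>! M \<rightarrow> i\<^sup>! j\<^sub>! M\<close>, and its
  adjoint morphism \<open>i\<^sub>* V \<rightarrow> j\<^sub>! M\<close> is the counit composed with \<open>i\<^sub>* b\<close>.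
\<close>

definition is_glued ::
  "('d, 'dm) tri_cat \<Rightarrow> ('x, 'xm) tri_cat \<Rightarrow> ('y, 'ym) tri_cat \<Rightarrow>
   ('d, 'dm, 'x, 'xm, 'y, 'ym) recollement_data \<Rightarrow> 'x \<Rightarrow> 'y \<Rightarrow> 'd \<Rightarrow> bool" where
  "is_glued D X Y \<R> M N Z \<longleftrightarrow>
     (\<exists>V V' b b' b'' K k k'.
        V \<in> co_ge Y N 1 \<and> V' \<in> co_le Y N 0 \<and>
        (V, FOb (i_shriek \<R>) (FOb (j_shriek \<R>) M), V', b, b', b'') \<in> Tri Y \<and>
        (FOb (i_push \<R>) V, FOb (j_shriek \<R>) M, K,
         counit_i_push_shriek \<R> (FOb (j_shriek \<R>) M) \<cdot>\<^bsub>D\<^esub> FMor (i_push \<R>) b, k, k') \<in> Tri D \<and>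
        is_dsum D Z (FOb (i_push \<R>) N) K)"

section \<open>Algebras and right modules\<close>

locale fd_algebra = field K + module K A + ring A
  for K :: "('k, 'x) ring_scheme" and A :: "('k, 'a, 'y) module_scheme" +
  assumes smult_mult_left: "\<lbrakk>k \<in> carrier K; x \<in> carrier A; y \<in> carrier A\<rbrakk>
      \<Longrightarrow> (k \<odot>\<^bsub>A\<^esub> x) \<otimes>\<^bsub>A\<^esub> y = k \<odot>\<^bsub>A\<^esub> (x \<otimes>\<^bsub>A\<^esub> y)"
    and smult_mult_right: "\<lbrakk>k \<in> carrier K; x \<in> carrier A; y \<in> carrier A\<rbrakk>
      \<Longrightarrow> x \<otimes>\<^bsub>A\<^esub> (k \<odot>\<^bsub>A\<^esub> y) = k \<odot>\<^bsub>A\<^esub> (x \<otimes>\<^bsub>A\<^esub> y)"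
    and finite_dim: "\<exists>S. finite S \<and> S \<subseteq> carrier A \<and>
      (\<forall>x\<in>carrier A. \<exists>c\<in>S \<rightarrow> carrier K. x = (\<Oplus>\<^bsub>A\<^esub>s\<in>S. c s \<odot>\<^bsub>A\<^esub> s))"

text \<open>
  HOL-Algebra's \<^locale>\<open>module\<close> requires a commutative ring. For a right module over a ring \<open>A\<close>
  we reuse its record: \<open>a \<odot>\<^bsub>M\<^esub> x\<close> is the right action \<open>x a\<close>.
\<close>

locale right_module = ring A + abelian_group M
  for A :: "('a, 'x) ring_scheme" and M :: "('a, 'e) module" +
  assumes act_closed: "\<lbrakk>a \<in> carrier A; x \<in> carrier M\<rbrakk> \<Longrightarrow> a \<odot>\<^bsub>M\<^esub> x \<in> carrier M"
    and act_l_distr: "\<lbrakk>a \<in> carrier A; b \<in> carrier A; x \<in> carrier M\<rbrakk>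
      \<Longrightarrow> (a \<oplus>\<^bsub>A\<^esub> b) \<odot>\<^bsub>M\<^esub> x = a \<odot>\<^bsub>M\<^esub> x \<oplus>\<^bsub>M\<^esub> b \<odot>\<^bsub>M\<^esub> x"
    and act_r_distr: "\<lbrakk>a \<in> carrier A; x \<in> carrier M; y \<in> carrier M\<rbrakk>
      \<Longrightarrow> a \<odot>\<^bsub>M\<^esub> (x \<oplus>\<^bsub>M\<^esub> y) = a \<odot>\<^bsub>M\<^esub> x \<oplus>\<^bsub>M\<^esub> a \<odot>\<^bsub>M\<^esub> y"
    and act_mult: "\<lbrakk>a \<in> carrier A; b \<in> carrier A; x \<in> carrier M\<rbrakk>
      \<Longrightarrow> (a \<otimes>\<^bsub>A\<^esub> b) \<odot>\<^bsub>M\<^esub> x = b \<odot>\<^bsub>M\<^esub> (a \<odot>\<^bsub>M\<^esub> x)"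
    and act_one: "x \<in> carrier M \<Longrightarrow> \<one>\<^bsub>A\<^esub> \<odot>\<^bsub>M\<^esub> x = x"

definition fg_modules :: "('a, 'x) ring_scheme \<Rightarrow> ('a, 'e) module set" where
  "fg_modules A = {M. right_module A M \<and>
     (\<exists>S. finite S \<and> S \<subseteq> carrier M \<and>
        (\<forall>x\<in>carrier M. \<exists>c\<in>S \<rightarrow> carrier A. x = (\<Oplus>\<^bsub>M\<^esub>s\<in>S. c s \<odot>\<^bsub>M\<^esub> s)))}"

text \<open>Homomorphisms are extensional functions, so that equal homomorphisms are equal functions.\<close>

definition mod_hom :: "('a, 'x) ring_scheme \<Rightarrow> ('a, 'e) module \<Rightarrow> ('a, 'e) module \<Rightarrow> ('e \<Rightarrow> 'e) set" where
  "mod_hom A M N = {f \<in> carrier M \<rightarrow>\<^sub>E carrier N.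
     (\<forall>x\<in>carrier M. \<forall>y\<in>carrier M. f (x \<oplus>\<^bsub>M\<^esub> y) = f x \<oplus>\<^bsub>N\<^esub> f y) \<and>
     (\<forall>a\<in>carrier A. \<forall>x\<in>carrier M. f (a \<odot>\<^bsub>M\<^esub> x) = a \<odot>\<^bsub>N\<^esub> f x)}"

definition projective :: "('a, 'x) ring_scheme \<Rightarrow> ('a, 'e) module \<Rightarrow> bool" where
  "projective A P \<longleftrightarrow> P \<in> fg_modules A \<and>
     (\<forall>M\<in>fg_modules A. \<forall>N\<in>fg_modules A. \<forall>p\<in>mod_hom A M N. \<forall>f\<in>mod_hom A P N.
        p ` carrier M = carrier N \<longrightarrow> (\<exists>g\<in>mod_hom A P M. \<forall>x\<in>carrier P. p (g x) = f x))"

section \<open>Bounded complexes\<close>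

record ('a, 'e) cpx =
  Md :: "int \<Rightarrow> ('a, 'e) module"
  df :: "int \<Rightarrow> 'e \<Rightarrow> 'e"

definition bounded_cpx :: "('a, 'x) ring_scheme \<Rightarrow> ('a, 'e) cpx set" where
  "bounded_cpx A = {X.
     (\<forall>n. Md X n \<in> fg_modules A \<and> df X n \<in> mod_hom A (Md X n) (Md X (n + 1)) \<and>
        (\<forall>x\<in>carrier (Md X n). df X (n + 1) (df X n x) = \<zero>\<^bsub>Md X (n + 2)\<^esub>)) \<and>
     (\<exists>N. \<forall>n. \<bar>n\<bar> > N \<longrightarrow> carrier (Md X n) = {\<zero>\<^bsub>Md X n\<^esub>})}"

definition chain_maps ::
  "('a, 'x) ring_scheme \<Rightarrow> ('a, 'e) cpx \<Rightarrow> ('a, 'e) cpx \<Rightarrow> (int \<Rightarrow> 'e \<Rightarrow> 'e) set" where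
  "chain_maps A X Y = {f. \<forall>n. f n \<in> mod_hom A (Md X n) (Md Y n) \<and>
     (\<forall>x\<in>carrier (Md X n). f (n + 1) (df X n x) = df Y n (f n x))}"

definition ch_id :: "('a, 'e) cpx \<Rightarrow> int \<Rightarrow> 'e \<Rightarrow> 'e" where
  "ch_id X = (\<lambda>n. \<lambda>x\<in>carrier (Md X n). x)"

definition ch_comp :: "('a, 'e) cpx \<Rightarrow> (int \<Rightarrow> 'e \<Rightarrow> 'e) \<Rightarrow> (int \<Rightarrow> 'e \<Rightarrow> 'e) \<Rightarrow> int \<Rightarrow> 'e \<Rightarrow> 'e" where
  "ch_comp X g f = (\<lambda>n. compose (carrier (Md X n)) (g n) (f n))"

definition ch_zero :: "('a, 'e) cpx \<Rightarrow> ('a, 'e) cpx \<Rightarrow> int \<Rightarrow> 'e \<Rightarrow> 'e" where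
  "ch_zero X Y = (\<lambda>n. \<lambda>x\<in>carrier (Md X n). \<zero>\<^bsub>Md Y n\<^esub>)"

definition ch_add ::
  "('a, 'e) cpx \<Rightarrow> ('a, 'e) cpx \<Rightarrow> (int \<Rightarrow> 'e \<Rightarrow> 'e) \<Rightarrow> (int \<Rightarrow> 'e \<Rightarrow> 'e) \<Rightarrow> int \<Rightarrow> 'e \<Rightarrow> 'e" where
  "ch_add X Y f g = (\<lambda>n. \<lambda>x\<in>carrier (Md X n). f n x \<oplus>\<^bsub>Md Y n\<^esub> g n x)"

definition homotopic ::
  "('a, 'x) ring_scheme \<Rightarrow> ('a, 'e) cpx \<Rightarrow> ('a, 'e) cpx \<Rightarrow> (int \<Rightarrow> 'e \<Rightarrow> 'e) \<Rightarrow> (int \<Rightarrow> 'e \<Rightarrow> 'e) \<Rightarrow> bool" where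
  "homotopic A X Y f g \<longleftrightarrow> (\<exists>s. (\<forall>n. s n \<in> mod_hom A (Md X n) (Md Y (n - 1))) \<and>
     (\<forall>n. \<forall>x\<in>carrier (Md X n).
        f n x = g n x \<oplus>\<^bsub>Md Y n\<^esub> (df Y (n - 1) (s n x) \<oplus>\<^bsub>Md Y n\<^esub> s (n + 1) (df X n x))))"

definition cycles :: "('a, 'e) cpx \<Rightarrow> int \<Rightarrow> 'e set" where
  "cycles X n = {x \<in> carrier (Md X n). df X n x = \<zero>\<^bsub>Md X (n + 1)\<^esub>}"

definition boundaries :: "('a, 'e) cpx \<Rightarrow> int \<Rightarrow> 'e set" where
  "boundaries X n = df X (n - 1) ` carrier (Md X (n - 1))"

definition cohomology :: "('a, 'e) cpx \<Rightarrow> int \<Rightarrow> 'e set set" where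
  "cohomology X n = {boundaries X n +>\<^bsub>Md X n\<^esub> x |x. x \<in> cycles X n}"

definition quasi_iso ::
  "('a, 'x) ring_scheme \<Rightarrow> ('a, 'e) cpx \<Rightarrow> ('a, 'e) cpx \<Rightarrow> (int \<Rightarrow> 'e \<Rightarrow> 'e) \<Rightarrow> bool" where
  "quasi_iso A X Y f \<longleftrightarrow> f \<in> chain_maps A X Y \<and>
     (\<forall>n. bij_betw (\<lambda>c. \<Union>x\<in>c. boundaries Y n +>\<^bsub>Md Y n\<^esub> f n x) (cohomology X n) (cohomology Y n))"

text \<open>\<open>X[n]\<close> has the differential \<open>(-1)\<^sup>n d\<close>.\<close>

definition cpx_shift :: "int \<Rightarrow> ('a, 'e) cpx \<Rightarrow> ('a, 'e) cpx" where
  "cpx_shift n X = \<lparr>Md = (\<lambda>k. Md X (k + n)),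
     df = (\<lambda>k. if even n then df X (k + n)
       else (\<lambda>x\<in>carrier (Md X (k + n)). \<ominus>\<^bsub>Md X (k + n + 1)\<^esub> df X (k + n) x))\<rparr>"

definition ch_shift :: "int \<Rightarrow> (int \<Rightarrow> 'e \<Rightarrow> 'e) \<Rightarrow> int \<Rightarrow> 'e \<Rightarrow> 'e" where
  "ch_shift n f = (\<lambda>k. f (k + n))"

text \<open>
  \<open>C\<close> is a mapping cone of \<open>u : U \<rightarrow> V\<close>: the maps \<open>\<pi>\<close> and \<open>q\<close> identify \<open>C\<^sup>n\<close> with \<open>U\<^sup>n\<^sup>+\<^sup>1 \<oplus> V\<^sup>n\<close> such
  that \<open>d (x, y) = (- d x, u x + d y)\<close>, and \<open>\<iota> : V \<rightarrow> C\<close> is the inclusion. That \<open>\<pi>\<close> is a chain map to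
  \<open>U[1]\<close> is the first component of the formula for \<open>d\<close>.
\<close>

definition is_cone ::
  "('a, 'x) ring_scheme \<Rightarrow> ('a, 'e) cpx \<Rightarrow> ('a, 'e) cpx \<Rightarrow> (int \<Rightarrow> 'e \<Rightarrow> 'e) \<Rightarrow>
   ('a, 'e) cpx \<Rightarrow> (int \<Rightarrow> 'e \<Rightarrow> 'e) \<Rightarrow> (int \<Rightarrow> 'e \<Rightarrow> 'e) \<Rightarrow> bool" where
  "is_cone A U V u C \<iota> \<pi> \<longleftrightarrow>
     \<iota> \<in> chain_maps A V C \<and> \<pi> \<in> chain_maps A C (cpx_shift 1 U) \<and>
     (\<exists>q. \<forall>n. q n \<in> mod_hom A (Md C n) (Md V n) \<and>
        bij_betw (\<lambda>z. (\<pi> n z, q n z)) (carrier (Md C n)) (carrier (Md U (n + 1)) \<times> carrier (Md V n)) \<and>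
        (\<forall>y\<in>carrier (Md V n). \<pi> n (\<iota> n y) = \<zero>\<^bsub>Md U (n + 1)\<^esub> \<and> q n (\<iota> n y) = y) \<and>
        (\<forall>z\<in>carrier (Md C n).
           q (n + 1) (df C n z) = u (n + 1) (\<pi> n z) \<oplus>\<^bsub>Md V (n + 1)\<^esub> df V n (q n z)))"

definition stalk :: "('a, 'e) module \<Rightarrow> ('a, 'e) cpx" where
  "stalk M = \<lparr>Md = (\<lambda>n. if n = 0 then M else M\<lparr>carrier := {\<zero>\<^bsub>M\<^esub>}\<rparr>),
     df = (\<lambda>n. \<lambda>x\<in>(if n = 0 then carrier M else {\<zero>\<^bsub>M\<^esub>}). \<zero>\<^bsub>M\<^esub>)\<rparr>"

text \<open>\<open>M\<close> has a projective resolution \<open>0 \<rightarrow> P\<^sup>-\<^sup>n \<rightarrow> \<dots> \<rightarrow> P\<^sup>0 \<rightarrow> M \<rightarrow> 0\<close>.\<close>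

definition proj_dim_le :: "('a, 'x) ring_scheme \<Rightarrow> ('a, 'e) module \<Rightarrow> nat \<Rightarrow> bool" where
  "proj_dim_le A M n \<longleftrightarrow> (\<exists>P\<in>bounded_cpx A. \<exists>\<epsilon>.
     (\<forall>i. projective A (Md P i)) \<and>
     (\<forall>i. i < - int n \<or> i > 0 \<longrightarrow> carrier (Md P i) = {\<zero>\<^bsub>Md P i\<^esub>}) \<and>
     quasi_iso A P (stalk M) \<epsilon>)"

text \<open>
  From here on module elements live in \<^typ>\<open>'a list\<close>. This type only serves as a universe: a finitely
  generated \<open>A\<close>-module is a quotient of some \<open>A\<^sup>n\<close>, whose elements are lists over \<^typ>\<open>'a\<close>, hence it is
  isomorphic to a module whose carrier is a subset of \<^typ>\<open>'a list\<close>.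
  For Noetherian rings the global dimension is determined by the finitely generated modules.
\<close>

definition finite_global_dimension :: "('a, 'x) ring_scheme \<Rightarrow> bool" where
  "finite_global_dimension A \<longleftrightarrow>
     (\<exists>n. \<forall>M\<in>(fg_modules A :: ('a, 'a list) module set). proj_dim_le A M n)"

section \<open>The bounded derived category\<close>

text \<open>
  The category of bounded complexes with homotopy classes of chain maps is localized at the
  quasi-isomorphisms. The morphisms \<open>X \<rightarrow> Y\<close> are the equivalence classes of roofs \<open>(U, s, f)\<close> with a
  quasi-isomorphism \<open>s : U \<rightarrow> X\<close> and a chain map \<open>f : U \<rightarrow> Y\<close>, standing for \<open>f s\<^sup>-\<^sup>1\<close>; they are tagged
  with \<open>X\<close> and \<open>Y\<close>.
\<close>

type_synonym ('a, 'e) roof = "('a, 'e) cpx \<times> (int \<Rightarrow> 'e \<Rightarrow> 'e) \<times> (int \<Rightarrow> 'e \<Rightarrow> 'e)"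
type_synonym ('a, 'e) der_mor = "('a, 'e) cpx \<times> ('a, 'e) cpx \<times> ('a, 'e) roof set"

definition roofs :: "('a, 'x) ring_scheme \<Rightarrow> ('a, 'e) cpx \<Rightarrow> ('a, 'e) cpx \<Rightarrow> ('a, 'e) roof set" where
  "roofs A X Y = {(U, s, f). U \<in> bounded_cpx A \<and> quasi_iso A U X s \<and> f \<in> chain_maps A U Y}"

definition roof_equiv ::
  "('a, 'x) ring_scheme \<Rightarrow> ('a, 'e) cpx \<Rightarrow> ('a, 'e) cpx \<Rightarrow> ('a, 'e) roof \<Rightarrow> ('a, 'e) roof \<Rightarrow> bool" where
  "roof_equiv A X Y = (\<lambda>(U, s, f) (V, t, g).
     (U, s, f) \<in> roofs A X Y \<and> (V, t, g) \<in> roofs A X Y \<and>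
     (\<exists>W\<in>bounded_cpx A. \<exists>u\<in>chain_maps A W U. \<exists>v\<in>chain_maps A W V.
        quasi_iso A W X (ch_comp W s u) \<and>
        homotopic A W X (ch_comp W s u) (ch_comp W t v) \<and>
        homotopic A W Y (ch_comp W f u) (ch_comp W g v)))"

definition der_class ::
  "('a, 'x) ring_scheme \<Rightarrow> ('a, 'e) cpx \<Rightarrow> ('a, 'e) cpx \<Rightarrow> ('a, 'e) roof \<Rightarrow> ('a, 'e) der_mor" where
  "der_class A X Y r = (X, Y, {r'. roof_equiv A X Y r r'})"

definition der_of_chain_map ::
  "('a, 'x) ring_scheme \<Rightarrow> ('a, 'e) cpx \<Rightarrow> ('a, 'e) cpx \<Rightarrow> (int \<Rightarrow> 'e \<Rightarrow> 'e) \<Rightarrow> ('a, 'e) der_mor" where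
  "der_of_chain_map A X Y f = der_class A X Y (X, ch_id X, f)"

text \<open>
  \<open>(g t\<^sup>-\<^sup>1) (f s\<^sup>-\<^sup>1) = (g v) (s u)\<^sup>-\<^sup>1\<close> whenever \<open>u\<close> is a quasi-isomorphism and \<open>f u\<close> is homotopic to \<open>t v\<close>.
  The composite consists of all roofs that are equivalent to one of these.
\<close>

definition der_comp ::
  "('a, 'x) ring_scheme \<Rightarrow> ('a, 'e) der_mor \<Rightarrow> ('a, 'e) der_mor \<Rightarrow> ('a, 'e) der_mor" where
  "der_comp A = (\<lambda>(Y', Z, \<psi>) (X, Y, \<phi>). (X, Z,
     {r. \<exists>U s f V t g W u v. (U, s, f) \<in> \<phi> \<and> (V, t, g) \<in> \<psi> \<and> W \<in> bounded_cpx A \<and>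
        quasi_iso A W U u \<and> v \<in> chain_maps A W V \<and>
        homotopic A W Y (ch_comp W f u) (ch_comp W t v) \<and>
        roof_equiv A X Z (W, ch_comp W s u, ch_comp W g v) r}))"

text \<open>Any two morphisms \<open>X \<rightarrow> Y\<close> have representatives \<open>f s\<^sup>-\<^sup>1\<close>, \<open>g s\<^sup>-\<^sup>1\<close>; their sum is \<open>(f + g) s\<^sup>-\<^sup>1\<close>.\<close>

definition der_plus ::
  "('a, 'x) ring_scheme \<Rightarrow> ('a, 'e) der_mor \<Rightarrow> ('a, 'e) der_mor \<Rightarrow> ('a, 'e) der_mor" where
  "der_plus A = (\<lambda>(X, Y, \<phi>) (X', Y', \<psi>). (X, Y,
     {r. \<exists>U s f g. (U, s, f) \<in> \<phi> \<and> (U, s, g) \<in> \<psi> \<and> roof_equiv A X Y (U, s, ch_add U Y f g) r}))"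

definition der_shift :: "int \<Rightarrow> ('a, 'e) der_mor \<Rightarrow> ('a, 'e) der_mor" where
  "der_shift n = (\<lambda>(X, Y, \<phi>). (cpx_shift n X, cpx_shift n Y,
     (\<lambda>(U, s, f). (cpx_shift n U, ch_shift n s, ch_shift n f)) ` \<phi>))"

definition der_cat ::
  "('a, 'x) ring_scheme \<Rightarrow> (('a, 'a list) cpx, ('a, 'a list) der_mor) shift_cat" where
  "der_cat A = \<lparr>Obj = bounded_cpx A,
     Hom = (\<lambda>X Y. der_class A X Y ` roofs A X Y),
     Idm = (\<lambda>X. der_of_chain_map A X X (ch_id X)),
     Cmp = der_comp A,
     Zer = (\<lambda>X Y. der_of_chain_map A X Y (ch_zero X Y)),
     Pls = der_plus A,
     Sh = cpx_shift,
     Shm = der_shift\<rparr>"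

definition cone_triangles ::
  "('a, 'x) ring_scheme \<Rightarrow> (('a, 'a list) cpx, ('a, 'a list) der_mor) triangle set" where
  "cone_triangles A =
     {(U, V, C, der_of_chain_map A U V u, der_of_chain_map A V C \<iota>,
        der_of_chain_map A C (cpx_shift 1 U) \<pi>) |U V C u \<iota> \<pi>.
      U \<in> bounded_cpx A \<and> V \<in> bounded_cpx A \<and> C \<in> bounded_cpx A \<and>
      u \<in> chain_maps A U V \<and> is_cone A U V u C \<iota> \<pi>}"

text \<open>
  The bounded derived category \<open>\<D>\<^sup>b(A)\<close> of finitely generated right \<open>A\<close>-modules; its distinguished
  triangles are those isomorphic to a triangle given by a mapping cone.
\<close>

definition Db ::
  "('a, 'x) ring_scheme \<Rightarrow> (('a, 'a list) cpx, ('a, 'a list) der_mor) tri_cat" where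
  "Db A = shift_cat.extend (der_cat A)
     (tri_cat.fields {t. is_triangle (der_cat A) t \<and>
        (\<exists>t'\<in>cone_triangles A. triangle_iso (der_cat A) t t')})"

end

theory Submission
  imports Defs
begin

text \<open>
  Write \<open>A = (\<beta>\<^sub>\<ge>\<^sub>1 i\<^sup>! j\<^sub>! X)[1]\<close> and \<open>V' = \<beta>\<^sub>\<le>\<^sub>0 i\<^sup>! j\<^sub>! X\<close>. Applying \<open>i\<^sup>*\<close>, \<open>i\<^sup>!\<close>, \<open>j\<^sup>*\<close> to the triangle
  that defines \<open>K\<^sub>X\<close> gives \<open>i\<^sup>* K\<^sub>X = A\<close>, \<open>i\<^sup>! K\<^sub>X = V'\<close>, \<open>j\<^sup>* K\<^sub>X = X\<close>. By adjunction and the triangle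
  \<open>i\<^sub>* i\<^sup>! K\<^sub>X \<rightarrow> K\<^sub>X \<rightarrow> j\<^sub>* j\<^sup>* K\<^sub>X\<close>, the object \<open>Z\<close> is tilting if and only if for all \<open>k < 0\<close>
  \<open>Hom(Y, V'[k])\<close>, \<open>Hom(A, Y[k])\<close> and \<open>Hom(A, V'[k])\<close> vanish. On the other hand \<open>i\<^sup>* j\<^sub>* X = (i\<^sup>! j\<^sub>! X)[1]\<close>
  sits in a triangle \<open>V' \<rightarrow> A \<rightarrow> i\<^sup>* j\<^sub>* X \<rightarrow> V'[1]\<close>. As \<open>A\<close> and \<open>V'\<close> are built from the \<open>Y[i]\<close> with
  \<open>i \<le> 0\<close> and \<open>i \<ge> 0\<close> respectively, \<open>Hom(Y, A[k]) = Hom(V', Y[k]) = 0\<close> for \<open>k < 0\<close>, and the long exact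
  sequences turn the three conditions into (a), (b) and (c).
\<close>

section \<open>Triangles and vanishing of morphisms\<close>

text \<open>The record extension is fixed as trivial, because \<open>thick\<close>,
  \<open>Hom_vanishes\<close> and \<open>triangle_functor\<close> are defined for plain
  \<open>tri_cat\<close> records.\<close>

locale plain_triangulated = triangulated_category T for T :: "('o, 'm) tri_cat" (structure)
begin

text \<open>Membership in \<open>Hom\<close> does not by itself put the endpoints into
  \<open>Obj\<close>, and the axioms ask for both; bundling them keeps side conditions
  short.\<close>

definition arr :: "'m \<Rightarrow> 'o \<Rightarrow> 'o \<Rightarrow> bool" where
  "arr f U V \<longleftrightarrow> U \<in> Obj T \<and> V \<in> Obj T \<and> f \<in> Hom T U V"

lemma arrD: "arr f U V \<Longrightarrow> U \<in> Obj T" "arr f U V \<Longrightarrow> V \<in> Obj T" "arr f U V \<Longrightarrow> f \<in> Hom T U V"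
  by (simp_all add: arr_def)

lemma arr_Idm [simp]: "U \<in> Obj T \<Longrightarrow> arr (Idm T U) U U"
  by (simp add: arr_def Idm_in)

lemma arr_Cmp [intro]: "arr f U V \<Longrightarrow> arr g V W \<Longrightarrow> arr (g \<cdot> f) U W"
  using Cmp_in unfolding arr_def by blast

lemma arr_Shm [intro]: "arr f U V \<Longrightarrow> arr (Shm T n f) (Sh T n U) (Sh T n V)"
  by (simp add: arr_def Sh_in Shm_in)

lemma arr_assoc: "arr f U V \<Longrightarrow> arr g V W \<Longrightarrow> arr h W P \<Longrightarrow> (h \<cdot> g) \<cdot> f = h \<cdot> (g \<cdot> f)"
  using Cmp_assoc unfolding arr_def by blast

lemma arr_Cmp_Idm [simp]: "arr f U V \<Longrightarrow> f \<cdot> Idm T U = f"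
  using Cmp_Idm unfolding arr_def by blast

lemma arr_Idm_Cmp [simp]: "arr f U V \<Longrightarrow> Idm T V \<cdot> f = f"
  using Idm_Cmp unfolding arr_def by blast

lemma arr_Shm_Cmp: "arr f U V \<Longrightarrow> arr g V W \<Longrightarrow> Shm T n (g \<cdot> f) = Shm T n g \<cdot> Shm T n f"
  using Shm_Cmp unfolding arr_def by blast

lemma Sh_Sh [simp]: "U \<in> Obj T \<Longrightarrow> Sh T m (Sh T n U) = Sh T (m + n) U"
  by (simp add: Sh_add)

lemma Shm_Shm: "arr f U V \<Longrightarrow> Shm T m (Shm T n f) = Shm T (m + n) f"
  using Shm_add[of U V f m n] unfolding arr_def by simp

lemma arr_Shm_0: "arr f U V \<Longrightarrow> Shm T 0 f = f"
  using Shm_0 unfolding arr_def by blast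

lemma arr_Sh_cancel:
  assumes f: "arr f U V" and g: "arr g U V" and e: "Shm T n f = Shm T n g"
  shows "f = g"
proof -
  have "f = Shm T (- n) (Shm T n f)" using Shm_Shm[OF f] arr_Shm_0[OF f] by simp
  also have "\<dots> = g" unfolding e using Shm_Shm[OF g] arr_Shm_0[OF g] by simp
  finally show ?thesis .
qed

section \<open>Zero morphisms and signs\<close>

lemma arr_Zer [simp]: "U \<in> Obj T \<Longrightarrow> V \<in> Obj T \<Longrightarrow> arr (Zer T U V) U V"
proof -
  assume o: "U \<in> Obj T" "V \<in> Obj T"
  interpret comm_group "hom_group T U V" using o by (rule Hom_group)
  show ?thesis using one_closed o by (simp add: arr_def hom_group_def)
qed

lemma Pls_Zer [simp]: "arr f U V \<Longrightarrow> Pls T f (Zer T U V) = f"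
proof -
  assume a: "arr f U V"
  interpret comm_group "hom_group T U V" using a by (auto simp: arr_def intro: Hom_group)
  show ?thesis using r_one[of f] a by (simp add: arr_def hom_group_def)
qed

text \<open>Composition, shifts and functors are only assumed to be additive; cancelling in
  \<open>f + f = f\<close> shows that they preserve zero.\<close>

lemma Pls_idem: "arr f U V \<Longrightarrow> Pls T f f = f \<Longrightarrow> f = Zer T U V"
proof -
  assume a: "arr f U V" "Pls T f f = f"
  interpret comm_group "hom_group T U V" using a by (auto simp: arr_def intro: Hom_group)
  show ?thesis using r_cancel_one[of f f] a by (simp add: arr_def hom_group_def)
qed

lemma arr_neg [intro]: "arr f U V \<Longrightarrow> arr (neg T U V f) U V"
proof -
  assume a: "arr f U V"
  interpret comm_group "hom_group T U V" using a by (auto simp: arr_def intro: Hom_group)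
  show ?thesis using inv_closed[of f] a by (simp add: arr_def hom_group_def neg_def)
qed

lemma Pls_neg: "arr f U V \<Longrightarrow> Pls T f (neg T U V f) = Zer T U V"
proof -
  assume a: "arr f U V"
  interpret comm_group "hom_group T U V" using a by (auto simp: arr_def intro: Hom_group)
  show ?thesis using r_inv[of f] a by (simp add: arr_def hom_group_def neg_def)
qed

lemma neg_unique: "arr f U V \<Longrightarrow> arr g U V \<Longrightarrow> Pls T f g = Zer T U V \<Longrightarrow> g = neg T U V f"
proof -
  assume a: "arr f U V" "arr g U V" "Pls T f g = Zer T U V"
  interpret comm_group "hom_group T U V" using a by (auto simp: arr_def intro: Hom_group)
  show ?thesis using inv_equality[of g f] m_comm[of f g] a by (simp add: arr_def hom_group_def neg_def)
qed

lemma neg_inj: "arr f U V \<Longrightarrow> arr g U V \<Longrightarrow> neg T U V f = neg T U V g \<Longrightarrow> f = g"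
proof -
  assume a: "arr f U V" "arr g U V" "neg T U V f = neg T U V g"
  interpret comm_group "hom_group T U V" using a by (auto simp: arr_def intro: Hom_group)
  show ?thesis using inv_inv[of g] inv_inv[of f] a by (simp add: arr_def hom_group_def neg_def)
qed

lemma neg_Zer [simp]: "U \<in> Obj T \<Longrightarrow> V \<in> Obj T \<Longrightarrow> neg T U V (Zer T U V) = Zer T U V"
  using neg_unique[of "Zer T U V" U V "Zer T U V"] by simp

lemma arr_Cmp_Pls: "arr f U V \<Longrightarrow> arr f' U V \<Longrightarrow> arr g V W \<Longrightarrow> g \<cdot> Pls T f f' = Pls T (g \<cdot> f) (g \<cdot> f')"
  using Cmp_Pls unfolding arr_def by blast

lemma arr_Pls_Cmp: "arr f U V \<Longrightarrow> arr g V W \<Longrightarrow> arr g' V W \<Longrightarrow> Pls T g g' \<cdot> f = Pls T (g \<cdot> f) (g' \<cdot> f)"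
  using Pls_Cmp unfolding arr_def by blast

lemma Cmp_Zer [simp]: "arr g V W \<Longrightarrow> U \<in> Obj T \<Longrightarrow> g \<cdot> Zer T U V = Zer T U W"
  using arr_Cmp_Pls[of "Zer T U V" U V "Zer T U V" g W] Pls_idem[of "g \<cdot> Zer T U V" U W] arrD[of g V W]
    arr_Cmp[of "Zer T U V" U V g W] arr_Zer[of U V]
  by simp

lemma Zer_Cmp [simp]: "arr f U V \<Longrightarrow> W \<in> Obj T \<Longrightarrow> Zer T V W \<cdot> f = Zer T U W"
  using arr_Pls_Cmp[of f U V "Zer T V W" W "Zer T V W"] Pls_idem[of "Zer T V W \<cdot> f" U W] arrD[of f U V]
    arr_Cmp[of f U V "Zer T V W" W] arr_Zer[of V W]
  by simp

lemma Shm_Zer [simp]: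
  assumes "U \<in> Obj T" "V \<in> Obj T"
  shows "Shm T n (Zer T U V) = Zer T (Sh T n U) (Sh T n V)"
proof (rule Pls_idem)
  show "arr (Shm T n (Zer T U V)) (Sh T n U) (Sh T n V)"
    using assms by (intro arr_Shm arr_Zer)
  show "Pls T (Shm T n (Zer T U V)) (Shm T n (Zer T U V)) = Shm T n (Zer T U V)"
    using Shm_Pls[of U V "Zer T U V" "Zer T U V" n] Pls_Zer[OF arr_Zer[OF assms]] arr_Zer[OF assms] assms
    by (simp add: arr_def)
qed

lemma Cmp_neg:
  assumes f: "arr f U V" and g: "arr g V W"
  shows "g \<cdot> neg T U V f = neg T U W (g \<cdot> f)"
  using arr_Cmp_Pls[OF f arr_neg[OF f] g] Pls_neg[OF f] Cmp_Zer[OF g arrD(1)[OF f]]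
  by (intro neg_unique[OF arr_Cmp[OF f g] arr_Cmp[OF arr_neg[OF f] g]]) simp

lemma neg_Cmp:
  assumes f: "arr f U V" and g: "arr g V W"
  shows "neg T V W g \<cdot> f = neg T U W (g \<cdot> f)"
  using arr_Pls_Cmp[OF f g arr_neg[OF g]] Pls_neg[OF g] Zer_Cmp[OF f arrD(2)[OF g]]
  by (intro neg_unique[OF arr_Cmp[OF f g] arr_Cmp[OF f arr_neg[OF g]]]) simp

lemma is_zero_Sh: "is_zero T N \<Longrightarrow> is_zero T (Sh T n N)"
  using Shm_Idm[of N n] Shm_Zer[of N N n] by (simp add: is_zero_def Sh_in)

lemma arr_from_zero:
  assumes N: "is_zero T N" and f: "arr f N U"
  shows "f = Zer T N U"
proof -
  have "f = f \<cdot> Zer T N N" using N arr_Cmp_Idm[OF f] by (simp add: is_zero_def)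
  with Cmp_Zer[OF f arrD(1)[OF f]] show ?thesis by simp
qed

lemma arr_to_zero:
  assumes N: "is_zero T N" and f: "arr f U N"
  shows "f = Zer T U N"
proof -
  have "f = Zer T N N \<cdot> f" using N arr_Idm_Cmp[OF f] by (simp add: is_zero_def)
  with Zer_Cmp[OF f arrD(2)[OF f]] show ?thesis by simp
qed

section \<open>Factorisation of morphisms through triangles\<close>

lemma Tri_arr:
  assumes "(U, V, W, f, g, h) \<in> Tri T"
  shows "U \<in> Obj T" "V \<in> Obj T" "W \<in> Obj T" "arr f U V" "arr g V W" "arr h W (Sh T 1 U)"
  using Tri_in[OF assms] by (auto simp: is_triangle_def arr_def Sh_in)

lemma is_triangleI: "arr f U V \<Longrightarrow> arr g V W \<Longrightarrow> arr h W (Sh T 1 U) \<Longrightarrow> is_triangle T (U, V, W, f, g, h)"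
  by (auto simp: is_triangle_def arr_def)

lemma Tri_rot:
  assumes "(U, V, W, f, g, h) \<in> Tri T"
  shows "(V, W, Sh T 1 U, g, h, neg T (Sh T 1 U) (Sh T 1 V) (Shm T 1 f)) \<in> Tri T"
  using Tri_rotate[OF Tri_in[OF assms]] assms by simp

lemma Tri_mor_arr:
  assumes "(U, V, W, f, g, h) \<in> Tri T" "(U', V', W', f', g', h') \<in> Tri T"
    and "arr a U U'" "arr b V V'" "b \<cdot> f = f' \<cdot> a"
  obtains c where "arr c W W'" "c \<cdot> g = g' \<cdot> b" "Shm T 1 a \<cdot> h = h' \<cdot> c"
proof -
  obtain c where "triangle_mor T (U, V, W, f, g, h) (U', V', W', f', g', h') a b c"
    using Tri_mor[OF assms(1,2) _ _ assms(5)] assms(3,4) by (auto simp: arr_def)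
  with that[of c] Tri_arr[OF assms(1)] Tri_arr[OF assms(2)] show thesis
    by (auto simp: triangle_mor_def arr_def)
qed

text \<open>\<open>g\<close> is a weak cokernel of \<open>f\<close>: the square formed by
  \<open>u\<close> and the zero map \<open>U -> N\<close> extends to a morphism into the triangle
  \<open>N -> P = P\<close>.\<close>

lemma Tri_factor_third:
  assumes t: "(U, V, W, f, g, h) \<in> Tri T" and u: "arr u V P" and z: "u \<cdot> f = Zer T U P"
  obtains c where "arr c W P" "u = c \<cdot> g"
proof -
  obtain N where N: "is_zero T N" using zero_ex by blast
  note No = N[unfolded is_zero_def, THEN conjunct1]
  note P = arrD(2)[OF u]
  have s: "is_triangle T (N, P, P, Zer T N P, Idm T P, Zer T P (Sh T 1 N))"
    using No P by (intro is_triangleI) (auto simp: Sh_in)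
  \<comment> \<open>Its rotation is the identity triangle of \<open>P\<close>, with the zero object
    \<open>Sh T 1 N\<close> as third term.\<close>
  have "(N, P, P, Zer T N P, Idm T P, Zer T P (Sh T 1 N)) \<in> Tri T"
    using Tri_rotate[OF s] Tri_Idm[OF P is_zero_Sh[OF N, of 1]] No P by (simp add: Sh_in)
  moreover have "u \<cdot> f = Zer T N P \<cdot> Zer T U N"
    using z Zer_Cmp[OF arr_Zer[OF Tri_arr(1)[OF t] No] P] by simp
  ultimately obtain c where "arr c W P" "c \<cdot> g = Idm T P \<cdot> u"
    using Tri_mor_arr[OF t _ arr_Zer[OF Tri_arr(1)[OF t] No] u] by blast
  with that u show thesis by simp
qed

text \<open>\<open>f\<close> is a weak kernel of \<open>g\<close>. Since \<open>Tri_mor\<close>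
  supplies only a third component, both triangles are rotated first, and the fill-in goes from
  \<open>Sh T 1 P\<close> to \<open>Sh T 1 U\<close>.\<close>

lemma Tri_factor_first:
  assumes t: "(U, V, W, f, g, h) \<in> Tri T" and u: "arr u P V" and z: "g \<cdot> u = Zer T P W"
  obtains c where "arr c P U" "u = f \<cdot> c"
proof -
  obtain N where N: "is_zero T N" using zero_ex by blast
  note No = N[unfolded is_zero_def, THEN conjunct1]
  note P = arrD(1)[OF u]
  have s: "(P, N, Sh T 1 P, Zer T P N, Zer T N (Sh T 1 P), neg T (Sh T 1 P) (Sh T 1 P) (Idm T (Sh T 1 P))) \<in> Tri T"
    using Tri_rot[OF Tri_Idm[OF P N]] P by (simp add: Shm_Idm)
  have z': "Zer T N W \<cdot> Zer T P N = g \<cdot> u"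
    using z Zer_Cmp[OF arr_Zer[OF P No] Tri_arr(3)[OF t]] by simp
  obtain c where c: "arr c (Sh T 1 P) (Sh T 1 U)"
    and e: "Shm T 1 u \<cdot> neg T (Sh T 1 P) (Sh T 1 P) (Idm T (Sh T 1 P))
        = neg T (Sh T 1 U) (Sh T 1 V) (Shm T 1 f) \<cdot> c"
    by (rule Tri_mor_arr[OF s Tri_rot[OF t] u arr_Zer[OF No Tri_arr(3)[OF t]] z'])
  \<comment> \<open>Unshifting \<open>c\<close> gives the factorisation; the minus signs of the two
    rotations cancel.\<close>
  define d where "d = Shm T (-1) c"
  have d: "arr d P U"
    using arr_Shm[OF c, of "-1"] P Tri_arr(1)[OF t] by (simp add: d_def Sh_0)
  have cd: "c = Shm T 1 d" using Shm_Shm[OF c, of 1 "-1"] arr_Shm_0[OF c] by (simp add: d_def)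
  note f1 = arr_Shm[OF Tri_arr(4)[OF t], of 1] and u1 = arr_Shm[OF u, of 1]
  have "neg T (Sh T 1 P) (Sh T 1 V) (Shm T 1 u) = neg T (Sh T 1 P) (Sh T 1 V) (Shm T 1 f \<cdot> c)"
    using e Cmp_neg[OF arr_Idm u1] neg_Cmp[OF c f1] u1 P by (simp add: Sh_in)
  then have "Shm T 1 u = Shm T 1 f \<cdot> c" using neg_inj u1 c f1 by blast
  then have "Shm T 1 u = Shm T 1 (f \<cdot> d)" using arr_Shm_Cmp[OF d Tri_arr(4)[OF t]] cd by simp
  then have "u = f \<cdot> d" using arr_Sh_cancel[OF u] d Tri_arr(4)[OF t] by blast
  with d that show thesis by blast
qed

section \<open>Isomorphic objects and triangles with a zero term\<close>

definition isoc :: "'o \<Rightarrow> 'o \<Rightarrow> bool" where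
  "isoc U V \<longleftrightarrow> (\<exists>f g. arr f U V \<and> arr g V U \<and> g \<cdot> f = Idm T U \<and> f \<cdot> g = Idm T V)"

lemma isocI: "arr f U V \<Longrightarrow> arr g V U \<Longrightarrow> g \<cdot> f = Idm T U \<Longrightarrow> f \<cdot> g = Idm T V \<Longrightarrow> isoc U V"
  unfolding isoc_def by blast

lemma isoc_refl: "U \<in> Obj T \<Longrightarrow> isoc U U"
  by (rule isocI[of "Idm T U" _ _ "Idm T U"]) (auto simp: arr_Cmp_Idm[OF arr_Idm])

lemma isoc_sym: "isoc U V \<Longrightarrow> isoc V U"
  unfolding isoc_def by blast

lemma isoc_trans:
  assumes "isoc U V" "isoc V W" shows "isoc U W"
proof -
  obtain f g where fg: "arr f U V" "arr g V U" "g \<cdot> f = Idm T U" "f \<cdot> g = Idm T V"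
    using assms(1) unfolding isoc_def by blast
  obtain h k where hk: "arr h V W" "arr k W V" "k \<cdot> h = Idm T V" "h \<cdot> k = Idm T W"
    using assms(2) unfolding isoc_def by blast
  have "(g \<cdot> k) \<cdot> (h \<cdot> f) = g \<cdot> (k \<cdot> h) \<cdot> f"
    using arr_assoc[OF arr_Cmp[OF fg(1) hk(1)] hk(2) fg(2)] arr_assoc[OF fg(1) hk(1,2)] by simp
  moreover have "(h \<cdot> f) \<cdot> (g \<cdot> k) = h \<cdot> (f \<cdot> g) \<cdot> k"
    using arr_assoc[OF arr_Cmp[OF hk(2) fg(2)] fg(1) hk(1)] arr_assoc[OF hk(2) fg(2,1)] by simp
  ultimately show ?thesis using fg hk
    by (intro isocI[OF arr_Cmp[OF fg(1) hk(1)] arr_Cmp[OF hk(2) fg(2)]]) simp_all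
qed

lemma isoc_Sh:
  assumes "isoc U V" shows "isoc (Sh T n U) (Sh T n V)"
proof -
  obtain f g where fg: "arr f U V" "arr g V U" "g \<cdot> f = Idm T U" "f \<cdot> g = Idm T V"
    using assms unfolding isoc_def by blast
  show ?thesis
    using arr_Shm_Cmp[OF fg(1,2), of n] arr_Shm_Cmp[OF fg(2,1), of n] fg(3,4) arrD(1,2)[OF fg(1)]
    by (intro isocI[OF arr_Shm[OF fg(1)] arr_Shm[OF fg(2)]]) (simp_all add: Shm_Idm)
qed

lemma is_iso_isoc: "is_iso T U V f \<Longrightarrow> U \<in> Obj T \<Longrightarrow> V \<in> Obj T \<Longrightarrow> isoc U V"
  unfolding is_iso_def isoc_def arr_def by blast

text \<open>As \<open>g\<close> and \<open>h\<close> are zero, the identity of \<open>V\<close>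
  factors through \<open>f\<close> and that of \<open>U[1]\<close> through \<open>-f[1]\<close>, so
  \<open>f\<close> has inverses on both sides.\<close>

lemma Tri_third_zero:
  assumes t: "(U, V, W, f, g, h) \<in> Tri T" and z: "is_zero T W"
  shows "isoc U V"
proof -
  note a = Tri_arr[OF t]
  obtain c where c: "arr c V U" "Idm T V = f \<cdot> c"
    using Tri_factor_first[OF t arr_Idm[OF a(2)]] a(5) arr_to_zero[OF z a(5)] by auto
  note t2 = Tri_rot[OF Tri_rot[OF t]]
  note f1 = arr_Shm[OF a(4), of 1]
  obtain d where d: "arr d (Sh T 1 V) (Sh T 1 U)"
    "Idm T (Sh T 1 U) = d \<cdot> neg T (Sh T 1 U) (Sh T 1 V) (Shm T 1 f)"
    using Tri_factor_third[OF t2 arr_Idm[OF Sh_in[OF a(1)]]] a(6) arr_from_zero[OF z a(6)] by auto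
  \<comment> \<open>The sign of the rotated triangle is moved to \<open>d\<close>, so that
    \<open>e\<close> is a left inverse of \<open>f\<close> itself.\<close>
  define e where "e = Shm T (-1) (neg T (Sh T 1 V) (Sh T 1 U) d)"
  have nd: "arr (neg T (Sh T 1 V) (Sh T 1 U) d) (Sh T 1 V) (Sh T 1 U)" using d(1) by blast
  have e: "arr e V U" using arr_Shm[OF nd, of "-1"] a by (simp add: e_def Sh_0)
  have "Shm T 1 (e \<cdot> f) = Shm T 1 e \<cdot> Shm T 1 f" using arr_Shm_Cmp[OF a(4) e] .
  also have "Shm T 1 e = neg T (Sh T 1 V) (Sh T 1 U) d"
    using Shm_Shm[OF nd, of 1 "-1"] arr_Shm_0[OF nd] by (simp add: e_def)
  also have "\<dots> \<cdot> Shm T 1 f = Idm T (Sh T 1 U)"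
    using neg_Cmp[OF f1 d(1)] Cmp_neg[OF f1 d(1)] d(2) by simp
  also have "\<dots> = Shm T 1 (Idm T U)" using a(1) by (simp add: Shm_Idm)
  finally have ef: "e \<cdot> f = Idm T U"
    by (rule arr_Sh_cancel[OF arr_Cmp[OF a(4) e] arr_Idm[OF a(1)]])
  have "e = e \<cdot> (f \<cdot> c)" using c(2)[symmetric] e by simp
  also have "\<dots> = c" using arr_assoc[OF c(1) a(4) e] ef c(1) by simp
  finally show ?thesis using isocI[OF a(4) e ef] c(2) by simp
qed

lemma Tri_first_zero: "(U, V, W, f, g, h) \<in> Tri T \<Longrightarrow> is_zero T U \<Longrightarrow> isoc V W"
  using Tri_third_zero[OF Tri_rot] is_zero_Sh by blast

lemma Tri_second_zero: "(U, V, W, f, g, h) \<in> Tri T \<Longrightarrow> is_zero T V \<Longrightarrow> isoc W (Sh T 1 U)"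
  using Tri_third_zero[OF Tri_rot[OF Tri_rot]] is_zero_Sh by blast

text \<open>The octahedron over \<open>U \<rightarrow> V = V\<close> compares the two cones.\<close>

lemma Tri_cone_unique:
  assumes s: "(U, V, W, f, g, h) \<in> Tri T" and t: "(U, V, W', f, g', h') \<in> Tri T"
  shows "isoc W W'"
proof -
  obtain N where N: "is_zero T N" using zero_ex by blast
  note a = Tri_arr[OF s]
  have "(U, V, W', Idm T V \<cdot> f, g', h') \<in> Tri T" using t a(4) by simp
  from octahedral[OF s Tri_Idm[OF a(2) N] this] Tri_third_zero[OF _ N] show ?thesis by blast
qed

text \<open>\<open>Tri_cone_unique\<close> needs two triangles with literally the same first
  morphism; this adjusts that morphism along an isomorphism.\<close>

lemma Tri_replace_first:
  assumes t: "(U, V, W, f, g, h) \<in> Tri T" and s: "arr s U' U" "arr s' U U'"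
    and e: "s' \<cdot> s = Idm T U'" "s \<cdot> s' = Idm T U"
  shows "(U', V, W, f \<cdot> s, g, Shm T 1 s' \<cdot> h) \<in> Tri T"
proof (rule Tri_iso[OF t])
  note a = Tri_arr[OF t]
  show "is_triangle T (U', V, W, f \<cdot> s, g, Shm T 1 s' \<cdot> h)"
    using a s by (intro is_triangleI) auto
  have i: "is_iso T U U' s'" "is_iso T V V (Idm T V)" "is_iso T W W (Idm T W)"
    using s e arr_Idm[OF a(2)] arr_Idm[OF a(3)] arr_Cmp_Idm[OF arr_Idm[OF a(2)]] arr_Cmp_Idm[OF arr_Idm[OF a(3)]]
    by (auto simp: is_iso_def arr_def)
  have "Idm T V \<cdot> f = (f \<cdot> s) \<cdot> s'" using arr_assoc[OF s(2,1) a(4)] e(2) a(4) by simp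
  moreover have "Shm T 1 s' \<cdot> h = (Shm T 1 s' \<cdot> h) \<cdot> Idm T W"
    using arr_Cmp_Idm[OF arr_Cmp[OF a(6) arr_Shm[OF s(2), of 1]]] by simp
  ultimately have "triangle_mor T (U, V, W, f, g, h) (U', V, W, f \<cdot> s, g, Shm T 1 s' \<cdot> h) s' (Idm T V) (Idm T W)"
    using a s arrD(3) arr_Cmp_Idm[OF a(5)] arr_Idm_Cmp[OF a(5)]
    by (simp add: triangle_mor_def Idm_in)
  with i show "triangle_iso T (U, V, W, f, g, h) (U', V, W, f \<cdot> s, g, Shm T 1 s' \<cdot> h)"
    unfolding triangle_iso_def by blast
qed

section \<open>Vanishing of Hom groups and long exact sequences\<close>

lemma Hom_vanishesI:
  "U \<in> Obj T \<Longrightarrow> V \<in> Obj T \<Longrightarrow> (\<And>u. arr u U V \<Longrightarrow> u = Zer T U V) \<Longrightarrow> Hom_vanishes T U V"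
  using arrD(3)[OF arr_Zer] by (auto simp: Hom_vanishes_def arr_def)

lemma Hom_vanishesD: "Hom_vanishes T U V \<Longrightarrow> arr u U V \<Longrightarrow> u = Zer T U V"
  by (simp add: Hom_vanishes_def arr_def)

lemma Hom_vanishes_to_zero: "is_zero T N \<Longrightarrow> U \<in> Obj T \<Longrightarrow> Hom_vanishes T U N"
  by (rule Hom_vanishesI) (simp, simp add: is_zero_def, erule (1) arr_to_zero)

text \<open>The identity is then zero. Composites of functors are shown to vanish in this
  way.\<close>

lemma Hom_vanishes_self: "U \<in> Obj T \<Longrightarrow> Hom_vanishes T U U \<Longrightarrow> is_zero T U"
  using Hom_vanishesD[of U U "Idm T U"] by (simp add: is_zero_def)

text \<open>\<open>u\<close> equals \<open>b' (b u a') a\<close>, whose middle factor lies in the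
  vanishing group. This serves for isomorphic objects and for direct summands.\<close>

lemma Hom_vanishes_retract:
  assumes v: "Hom_vanishes T U V"
    and a: "arr a U' U" "arr a' U U'" "a' \<cdot> a = Idm T U'"
    and b: "arr b V' V" "arr b' V V'" "b' \<cdot> b = Idm T V'"
  shows "Hom_vanishes T U' V'"
proof (rule Hom_vanishesI)
  fix u assume u: "arr u U' V'"
  have m: "arr (b \<cdot> u \<cdot> a') U V" using u a b by blast
  have "u = (b' \<cdot> b) \<cdot> u \<cdot> (a' \<cdot> a)" using u a(3) b(3) by simp
  also have "\<dots> = b' \<cdot> (b \<cdot> u \<cdot> a') \<cdot> a"
    using arr_assoc[OF arr_Cmp[OF arr_Cmp[OF a(1,2)] u] b(1,2)] arr_assoc[OF a(1) arr_Cmp[OF a(2) u] b(1)]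
      arr_assoc[OF a(1,2) u] by simp
  also have "\<dots> = Zer T U' V'"
    using Hom_vanishesD[OF v m] a(1) b(1,2) by (simp add: arrD)
  finally show "u = Zer T U' V'" .
qed (use a b in \<open>auto dest: arrD\<close>)

lemma Hom_vanishes_isoc:
  assumes "isoc U U'" "isoc V V'"
  shows "Hom_vanishes T U V \<longleftrightarrow> Hom_vanishes T U' V'"
proof -
  obtain f f' g g' where "arr f U U'" "arr f' U' U" "f' \<cdot> f = Idm T U" "f \<cdot> f' = Idm T U'"
    "arr g V V'" "arr g' V' V" "g' \<cdot> g = Idm T V" "g \<cdot> g' = Idm T V'"
    using assms unfolding isoc_def by blast
  then show ?thesis using Hom_vanishes_retract by blast
qed

lemma Hom_vanishes_Sh:
  assumes "U \<in> Obj T" "V \<in> Obj T"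
  shows "Hom_vanishes T (Sh T n U) (Sh T n V) \<longleftrightarrow> Hom_vanishes T U V"
proof -
  \<comment> \<open>One implication for arbitrary arguments; the converse is its instance for the
    shift by \<open>-n\<close>.\<close>
  have "Hom_vanishes T (Sh T n U) (Sh T n V)" if "Hom_vanishes T U V" "U \<in> Obj T" "V \<in> Obj T" for n U V
  proof (rule Hom_vanishesI)
    fix u assume u: "arr u (Sh T n U) (Sh T n V)"
    have "arr (Shm T (-n) u) U V" using arr_Shm[OF u, of "-n"] that by (simp add: Sh_0)
    then have "Shm T (-n) u = Zer T U V" using Hom_vanishesD that by blast
    then have "Shm T n (Shm T (-n) u) = Zer T (Sh T n U) (Sh T n V)" using that by simp
    then show "u = Zer T (Sh T n U) (Sh T n V)" using Shm_Shm[OF u, of n "-n"] arr_Shm_0[OF u] by simp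
  qed (use that in \<open>auto simp: Sh_in\<close>)
  from this[of U V n] this[of "Sh T n U" "Sh T n V" "-n"] assms show ?thesis
    by (auto simp: Sh_in Sh_0)
qed

abbreviation hv :: "int \<Rightarrow> 'o \<Rightarrow> 'o \<Rightarrow> bool" where
  "hv k U V \<equiv> Hom_vanishes T U (Sh T k V)"

lemma hv_Sh_right: "V \<in> Obj T \<Longrightarrow> hv k U (Sh T n V) \<longleftrightarrow> hv (k + n) U V"
  by simp

lemma hv_Sh_left: "U \<in> Obj T \<Longrightarrow> V \<in> Obj T \<Longrightarrow> hv k (Sh T n U) V \<longleftrightarrow> hv (k - n) U V"
  using Hom_vanishes_Sh[of "Sh T n U" "Sh T k V" "-n"] by (simp add: Sh_in Sh_0 algebra_simps)

text \<open>With the shift moved to the source, a triangle or direct sum in the target can stay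
  unshifted.\<close>

lemma hv_left: "U \<in> Obj T \<Longrightarrow> V \<in> Obj T \<Longrightarrow> hv k U V \<longleftrightarrow> Hom_vanishes T (Sh T (-k) U) V"
  using Hom_vanishes_Sh[of U "Sh T k V" "-k"] by (simp add: Sh_in Sh_0)

lemma hv_isoc: "isoc U U' \<Longrightarrow> isoc V V' \<Longrightarrow> hv k U V \<longleftrightarrow> hv k U' V'"
  using Hom_vanishes_isoc isoc_Sh by blast

lemma Hom_vanishes_Tri_right:
  assumes t: "(U, V, W, f, g, h) \<in> Tri T" and P: "P \<in> Obj T"
    and v: "Hom_vanishes T P U" "Hom_vanishes T P W"
  shows "Hom_vanishes T P V"
proof (rule Hom_vanishesI)
  fix u assume u: "arr u P V"
  note a = Tri_arr[OF t]
  obtain c where c: "arr c P U" "u = f \<cdot> c"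
    by (rule Tri_factor_first[OF t u Hom_vanishesD[OF v(2) arr_Cmp[OF u a(5)]]])
  then show "u = Zer T P V" using Hom_vanishesD[OF v(1) c(1)] a(4) P by simp
qed (rule P Tri_arr(2)[OF t])+

lemma Hom_vanishes_Tri_left:
  assumes t: "(U, V, W, f, g, h) \<in> Tri T" and P: "P \<in> Obj T"
    and v: "Hom_vanishes T U P" "Hom_vanishes T W P"
  shows "Hom_vanishes T V P"
proof (rule Hom_vanishesI)
  fix u assume u: "arr u V P"
  note a = Tri_arr[OF t]
  obtain c where c: "arr c W P" "u = c \<cdot> g"
    by (rule Tri_factor_third[OF t u Hom_vanishesD[OF v(1) arr_Cmp[OF a(4) u]]])
  then show "u = Zer T V P" using Hom_vanishesD[OF v(2) c(1)] a(5) P by simp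
qed (rule P Tri_arr(2)[OF t])+

text \<open>Exactness of the long sequence of \<open>Hom(P, -)\<close> at \<open>V\<close>,
  \<open>W\<close> and \<open>U\<close>, read off from the triangle and its two rotations.\<close>

lemma hv_Tri_right:
  assumes t: "(U, V, W, f, g, h) \<in> Tri T" and P: "P \<in> Obj T"
  shows "hv k P U \<Longrightarrow> hv k P W \<Longrightarrow> hv k P V"
    and "hv k P V \<Longrightarrow> hv (k + 1) P U \<Longrightarrow> hv k P W"
    and "hv (k - 1) P W \<Longrightarrow> hv k P V \<Longrightarrow> hv k P U"
proof -
  note a = Tri_arr[OF t] and t1 = Tri_rot[OF t]
  note t2 = Tri_rot[OF t1]
  have s: "Sh T (- k) P \<in> Obj T" for k using P Sh_in by blast
  show "hv k P U \<Longrightarrow> hv k P W \<Longrightarrow> hv k P V"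
    using Hom_vanishes_Tri_right[OF t s] hv_left P a by simp
  show "hv k P V \<Longrightarrow> hv (k + 1) P U \<Longrightarrow> hv k P W"
    using Hom_vanishes_Tri_right[OF t1 s, of k] hv_left[OF P a(2), of k] hv_left[OF P a(3), of k]
      hv_left[OF P Sh_in[OF a(1), of 1], of k] a by simp
  \<comment> \<open>The middle term after two rotations is \<open>Sh T 1 U\<close>, so degree
    \<open>k - 1\<close> there is degree \<open>k\<close> for \<open>U\<close>.\<close>
  show "hv (k - 1) P W \<Longrightarrow> hv k P V \<Longrightarrow> hv k P U"
    using Hom_vanishes_Tri_right[OF t2 s, of "k - 1"] hv_left[OF P a(3), of "k - 1"]
      hv_left[OF P Sh_in[OF a(1), of 1], of "k - 1"] hv_left[OF P Sh_in[OF a(2), of 1], of "k - 1"] a by simp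
qed

text \<open>In the contravariant sequence the connecting map goes from \<open>Hom(U, P[k])\<close>
  to \<open>Hom(W, P[k+1])\<close>.\<close>

lemma hv_Tri_left:
  assumes t: "(U, V, W, f, g, h) \<in> Tri T" and P: "P \<in> Obj T"
  shows "hv k U P \<Longrightarrow> hv k W P \<Longrightarrow> hv k V P"
    and "hv k V P \<Longrightarrow> hv (k - 1) U P \<Longrightarrow> hv k W P"
    and "hv (k + 1) W P \<Longrightarrow> hv k V P \<Longrightarrow> hv k U P"
proof -
  note a = Tri_arr[OF t] and t1 = Tri_rot[OF t]
  note t2 = Tri_rot[OF t1]
  have s: "Sh T k P \<in> Obj T" for k using P Sh_in by blast
  show "hv k U P \<Longrightarrow> hv k W P \<Longrightarrow> hv k V P"
    using Hom_vanishes_Tri_left[OF t s] by simp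
  show "hv k V P \<Longrightarrow> hv (k - 1) U P \<Longrightarrow> hv k W P"
    using Hom_vanishes_Tri_left[OF t1 s] hv_Sh_left[OF a(1) P, of 1 k] by simp
  show "hv (k + 1) W P \<Longrightarrow> hv k V P \<Longrightarrow> hv k U P"
    using Hom_vanishes_Tri_left[OF t2 s, of "k + 1"] hv_Sh_left[OF a(1) P, of 1 "k + 1"]
      hv_Sh_left[OF a(2) P, of 1 "k + 1"] by simp
qed

section \<open>Direct sums\<close>

lemma is_dsumE:
  assumes "is_dsum T S U V"
  obtains a b p q where "arr a U S" "arr b V S" "arr p S U" "arr q S V" "p \<cdot> a = Idm T U"
    "q \<cdot> b = Idm T V" "q \<cdot> a = Zer T U V" "p \<cdot> b = Zer T V U" "Pls T (a \<cdot> p) (b \<cdot> q) = Idm T S"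
  using assms unfolding is_dsum_def arr_def by blast

lemma is_dsumI:
  assumes "arr a U S" "arr b V S" "arr p S U" "arr q S V" "p \<cdot> a = Idm T U"
    "q \<cdot> b = Idm T V" "q \<cdot> a = Zer T U V" "p \<cdot> b = Zer T V U" "Pls T (a \<cdot> p) (b \<cdot> q) = Idm T S"
  shows "is_dsum T S U V"
  using assms unfolding is_dsum_def arr_def by blast

text \<open>\<open>u = a p u + b q u\<close> gives one direction; for the other, \<open>U\<close>
  and \<open>V\<close> are retracts of \<open>S\<close>.\<close>

lemma Hom_vanishes_dsum_right:
  assumes d: "is_dsum T S U V" and P: "P \<in> Obj T"
  shows "Hom_vanishes T P S \<longleftrightarrow> Hom_vanishes T P U \<and> Hom_vanishes T P V"
proof -
  obtain a b p q where m: "arr a U S" "arr b V S" "arr p S U" "arr q S V" "p \<cdot> a = Idm T U"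
    "q \<cdot> b = Idm T V" "Pls T (a \<cdot> p) (b \<cdot> q) = Idm T S" using d by (rule is_dsumE)
  have i: "Idm T P \<cdot> Idm T P = Idm T P" "arr (Idm T P) P P" using arr_Idm[OF P] by simp_all
  have "Hom_vanishes T P S" if v: "Hom_vanishes T P U" "Hom_vanishes T P V"
  proof (rule Hom_vanishesI)
    fix u assume u: "arr u P S"
    have "u = Pls T (a \<cdot> p) (b \<cdot> q) \<cdot> u" using m(7) u by simp
    also have "\<dots> = Pls T ((a \<cdot> p) \<cdot> u) ((b \<cdot> q) \<cdot> u)"
      using arr_Pls_Cmp[OF u arr_Cmp[OF m(3,1)] arr_Cmp[OF m(4,2)]] .
    also have "\<dots> = Pls T (a \<cdot> p \<cdot> u) (b \<cdot> q \<cdot> u)"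
      using arr_assoc[OF u m(3,1)] arr_assoc[OF u m(4,2)] by simp
    also have "\<dots> = Zer T P S"
      using Hom_vanishesD[OF v(1) arr_Cmp[OF u m(3)]] Hom_vanishesD[OF v(2) arr_Cmp[OF u m(4)]]
        m(1,2) P arrD(2)[OF m(1)] Pls_Zer[OF arr_Zer] by simp
    finally show "u = Zer T P S" .
  qed (rule P arrD(2)[OF m(1)])+
  moreover have "Hom_vanishes T P S \<Longrightarrow> Hom_vanishes T P U"
    using Hom_vanishes_retract[OF _ i(2,2,1) m(1,3,5)] .
  moreover have "Hom_vanishes T P S \<Longrightarrow> Hom_vanishes T P V"
    using Hom_vanishes_retract[OF _ i(2,2,1) m(2,4,6)] .
  ultimately show ?thesis by blast
qed

lemma Hom_vanishes_dsum_left: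
  assumes d: "is_dsum T S U V" and P: "P \<in> Obj T"
  shows "Hom_vanishes T S P \<longleftrightarrow> Hom_vanishes T U P \<and> Hom_vanishes T V P"
proof -
  obtain a b p q where m: "arr a U S" "arr b V S" "arr p S U" "arr q S V" "p \<cdot> a = Idm T U"
    "q \<cdot> b = Idm T V" "Pls T (a \<cdot> p) (b \<cdot> q) = Idm T S" using d by (rule is_dsumE)
  have i: "Idm T P \<cdot> Idm T P = Idm T P" "arr (Idm T P) P P" using arr_Idm[OF P] by simp_all
  have "Hom_vanishes T S P" if v: "Hom_vanishes T U P" "Hom_vanishes T V P"
  proof (rule Hom_vanishesI)
    fix u assume u: "arr u S P"
    have "u = u \<cdot> Pls T (a \<cdot> p) (b \<cdot> q)" using m(7) u by simp
    also have "\<dots> = Pls T (u \<cdot> a \<cdot> p) (u \<cdot> b \<cdot> q)"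
      using arr_Cmp_Pls[OF arr_Cmp[OF m(3,1)] arr_Cmp[OF m(4,2)] u] .
    also have "\<dots> = Pls T ((u \<cdot> a) \<cdot> p) ((u \<cdot> b) \<cdot> q)"
      using arr_assoc[OF m(3,1) u] arr_assoc[OF m(4,2) u] by simp
    also have "\<dots> = Zer T S P"
      using Hom_vanishesD[OF v(1) arr_Cmp[OF m(1) u]] Hom_vanishesD[OF v(2) arr_Cmp[OF m(2) u]]
        m(3,4) P arrD(2)[OF m(1)] Pls_Zer[OF arr_Zer] by simp
    finally show "u = Zer T S P" .
  qed (rule P arrD(2)[OF m(1)])+
  moreover have "Hom_vanishes T S P \<Longrightarrow> Hom_vanishes T U P"
    using Hom_vanishes_retract[OF _ m(1,3,5) i(2,2,1)] .
  moreover have "Hom_vanishes T S P \<Longrightarrow> Hom_vanishes T V P"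
    using Hom_vanishes_retract[OF _ m(2,4,6) i(2,2,1)] .
  ultimately show ?thesis by blast
qed

lemma is_dsum_Obj: "is_dsum T S U V \<Longrightarrow> S \<in> Obj T" "is_dsum T S U V \<Longrightarrow> U \<in> Obj T" "is_dsum T S U V \<Longrightarrow> V \<in> Obj T"
  unfolding is_dsum_def by simp_all

lemma hv_dsum_left:
  "is_dsum T S U V \<Longrightarrow> P \<in> Obj T \<Longrightarrow> hv k S P \<longleftrightarrow> hv k U P \<and> hv k V P"
  by (rule Hom_vanishes_dsum_left) (simp_all add: Sh_in)

lemma hv_dsum_right:
  "is_dsum T S U V \<Longrightarrow> P \<in> Obj T \<Longrightarrow> hv k P S \<longleftrightarrow> hv k P U \<and> hv k P V"
  using Hom_vanishes_dsum_right[of S U V "Sh T (-k) P"] by (simp add: hv_left is_dsum_Obj Sh_in)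

text \<open>The closure rules \<open>summand\<close> extract only the first summand; the swap makes
  the second one available.\<close>

lemma is_dsum_comm: "is_dsum T S U V \<Longrightarrow> is_dsum T S V U"
proof (erule is_dsumE)
  fix a b p q assume m: "arr a U S" "arr b V S" "arr p S U" "arr q S V" "p \<cdot> a = Idm T U"
    "q \<cdot> b = Idm T V" "q \<cdot> a = Zer T U V" "p \<cdot> b = Zer T V U" "Pls T (a \<cdot> p) (b \<cdot> q) = Idm T S"
  interpret comm_group "hom_group T S S" using m by (auto simp: arr_def intro: Hom_group)
  have "Pls T (b \<cdot> q) (a \<cdot> p) = Idm T S"
    using m_comm[of "b \<cdot> q" "a \<cdot> p"] m(9) arr_Cmp[OF m(3,1)] arr_Cmp[OF m(4,2)]
    by (simp add: arr_def hom_group_def)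
  then show ?thesis using is_dsumI[OF m(2,1,4,3,6,5,8,7)] by blast
qed

lemma is_dsum_isoc_zero:
  assumes "isoc U V" "is_zero T N"
  shows "is_dsum T U V N"
proof -
  obtain f g where fg: "arr f U V" "arr g V U" "g \<cdot> f = Idm T U" "f \<cdot> g = Idm T V"
    using assms(1) unfolding isoc_def by blast
  have o: "U \<in> Obj T" "V \<in> Obj T" "N \<in> Obj T" and N: "Idm T N = Zer T N N"
    using arrD(1,2)[OF fg(1)] assms(2) by (simp_all add: is_zero_def)
  note z = arr_Zer[OF o(1,3)] arr_Zer[OF o(3,1)]
  show ?thesis
  proof (rule is_dsumI[OF fg(2) z(2) fg(1) z(1) fg(4)])
    show "Zer T U N \<cdot> Zer T N U = Idm T N" using Zer_Cmp[OF z(2) o(3)] N by simp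
    show "Zer T U N \<cdot> g = Zer T V N" using Zer_Cmp[OF fg(2) o(3)] .
    show "f \<cdot> Zer T N U = Zer T N V" using Cmp_Zer[OF fg(1) o(3)] .
    show "Pls T (g \<cdot> f) (Zer T N U \<cdot> Zer T U N) = Idm T U"
      unfolding fg(3) Zer_Cmp[OF z(1) o(1)] by (rule Pls_Zer[OF arr_Idm[OF o(1)]])
  qed
qed

section \<open>Closures generated by objects\<close>

lemma add_ext_closure_Obj: "U \<in> add_ext_closure T G \<Longrightarrow> G \<subseteq> Obj T \<Longrightarrow> U \<in> Obj T"
  by (induction rule: add_ext_closure.induct) (auto simp: is_dsum_def dest: Tri_arr)

text \<open>For fixed \<open>k\<close> and \<open>P\<close>, the objects \<open>U\<close> with
  \<open>hv k U P\<close> are closed under every rule, so testing the generators suffices.\<close>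

lemma hv_add_ext_closure_left:
  assumes "U \<in> add_ext_closure T G" "P \<in> Obj T" "\<And>M. M \<in> G \<Longrightarrow> hv k M P"
  shows "hv k U P"
  using assms(1)
proof induction
  case (ext U V W f g h)
  then show ?case by (intro hv_Tri_left(1)[OF ext.hyps(1) assms(2)])
next
  case (summand U V V')
  then show ?case using hv_dsum_left[OF summand.hyps(2) assms(2)] by simp
next
  case (dsum U V W)
  then show ?case using hv_dsum_left[OF dsum.hyps(3) assms(2)] by simp
qed (rule assms(3))

lemma hv_add_ext_closure_right:
  assumes "U \<in> add_ext_closure T G" "P \<in> Obj T" "\<And>M. M \<in> G \<Longrightarrow> hv k P M"
  shows "hv k P U"
  using assms(1)
proof induction
  case (ext U V W f g h)
  then show ?case by (intro hv_Tri_right(1)[OF ext.hyps(1) assms(2)])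
next
  case (summand U V V')
  then show ?case using hv_dsum_right[OF summand.hyps(2) assms(2)] by simp
next
  case (dsum U V W)
  then show ?case using hv_dsum_right[OF dsum.hyps(3) assms(2)] by simp
qed (rule assms(3))

lemma thick_Obj: "U \<in> thick T M \<Longrightarrow> M \<in> Obj T \<Longrightarrow> U \<in> Obj T"
  by (induction rule: thick.induct) (auto simp: is_dsum_def Sh_in dest: Tri_arr)

text \<open>\<open>V\<close> is a summand of \<open>U\<close> with zero complement.\<close>

lemma thick_isoc:
  assumes "U \<in> thick T M" "isoc U V"
  shows "V \<in> thick T M"
proof -
  obtain N where "is_zero T N" using zero_ex by blast
  from thick.summand[OF assms(1) is_dsum_isoc_zero[OF assms(2) this]] show ?thesis .
qed

end

section \<open>Triangle functors and adjunctions\<close>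

locale exact_functor =
  S: plain_triangulated S + T: plain_triangulated T + triangle_functor S T F for S T F
begin

lemma F_arr: "S.arr f U V \<Longrightarrow> T.arr (FMor F f) (FOb F U) (FOb F V)"
  by (simp add: S.arr_def T.arr_def FOb_in FMor_in)

lemma F_Cmp: "S.arr f U V \<Longrightarrow> S.arr g V W \<Longrightarrow> FMor F (g \<cdot>\<^bsub>S\<^esub> f) = FMor F g \<cdot>\<^bsub>T\<^esub> FMor F f"
  unfolding S.arr_def using FMor_Cmp by blast

lemma F_isoc:
  assumes "S.isoc U V" shows "T.isoc (FOb F U) (FOb F V)"
proof -
  obtain f g where fg: "S.arr f U V" "S.arr g V U" "g \<cdot>\<^bsub>S\<^esub> f = Idm S U" "f \<cdot>\<^bsub>S\<^esub> g = Idm S V"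
    using assms unfolding S.isoc_def by blast
  show ?thesis
    using F_Cmp[OF fg(1,2)] F_Cmp[OF fg(2,1)] fg(3,4) S.arrD(1,2)[OF fg(1)]
    by (intro T.isocI[OF F_arr[OF fg(1)] F_arr[OF fg(2)]]) (simp_all add: FMor_Idm)
qed

lemma F_Zer:
  assumes o: "U \<in> Obj S" "V \<in> Obj S"
  shows "FMor F (Zer S U V) = Zer T (FOb F U) (FOb F V)"
  using FMor_Pls[OF o S.arrD(3)[OF S.arr_Zer[OF o]] S.arrD(3)[OF S.arr_Zer[OF o]]] S.Pls_Zer[OF S.arr_Zer[OF o]]
  by (intro T.Pls_idem[OF F_arr[OF S.arr_Zer[OF o]]]) simp

lemma F_dsum:
  assumes "is_dsum S P U V"
  shows "is_dsum T (FOb F P) (FOb F U) (FOb F V)"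
proof -
  obtain a b p q where m: "S.arr a U P" "S.arr b V P" "S.arr p P U" "S.arr q P V"
    "p \<cdot>\<^bsub>S\<^esub> a = Idm S U" "q \<cdot>\<^bsub>S\<^esub> b = Idm S V" "q \<cdot>\<^bsub>S\<^esub> a = Zer S U V" "p \<cdot>\<^bsub>S\<^esub> b = Zer S V U"
    "Pls S (a \<cdot>\<^bsub>S\<^esub> p) (b \<cdot>\<^bsub>S\<^esub> q) = Idm S P"
    using assms by (rule S.is_dsumE)
  note o = S.arrD(1)[OF m(1)] S.arrD(1)[OF m(2)] S.arrD(1)[OF m(3)]
  show ?thesis
  proof (rule T.is_dsumI[OF F_arr[OF m(1)] F_arr[OF m(2)] F_arr[OF m(3)] F_arr[OF m(4)]])
    show "FMor F p \<cdot>\<^bsub>T\<^esub> FMor F a = Idm T (FOb F U)"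
      using F_Cmp[OF m(1,3)] m(5) FMor_Idm[OF o(1)] by simp
    show "FMor F q \<cdot>\<^bsub>T\<^esub> FMor F b = Idm T (FOb F V)"
      using F_Cmp[OF m(2,4)] m(6) FMor_Idm[OF o(2)] by simp
    show "FMor F q \<cdot>\<^bsub>T\<^esub> FMor F a = Zer T (FOb F U) (FOb F V)"
      using F_Cmp[OF m(1,4)] m(7) F_Zer[OF o(1,2)] by simp
    show "FMor F p \<cdot>\<^bsub>T\<^esub> FMor F b = Zer T (FOb F V) (FOb F U)"
      using F_Cmp[OF m(2,3)] m(8) F_Zer[OF o(2,1)] by simp
    show "Pls T (FMor F a \<cdot>\<^bsub>T\<^esub> FMor F p) (FMor F b \<cdot>\<^bsub>T\<^esub> FMor F q) = Idm T (FOb F P)"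
      using F_Cmp[OF m(3,1)] F_Cmp[OF m(4,2)] m(9) FMor_Idm[OF o(3)]
        FMor_Pls[OF o(3,3) S.arrD(3)[OF S.arr_Cmp[OF m(3,1)]] S.arrD(3)[OF S.arr_Cmp[OF m(4,2)]]] by simp
  qed
qed

lemma F_Sh_1: "U \<in> Obj S \<Longrightarrow> T.isoc (FOb F (Sh S 1 U)) (Sh T 1 (FOb F U))"
  by (rule T.is_iso_isoc[OF FSh_iso]) (simp_all add: FOb_in S.Sh_in T.Sh_in)

text \<open>The structure maps \<open>FSh\<close> concern the shift by 1 only; induction in both
  directions extends them to all integers.\<close>

lemma F_Sh:
  assumes U: "U \<in> Obj S"
  shows "T.isoc (FOb F (Sh S n U)) (Sh T n (FOb F U))"
proof (induction n rule: int_induct[of _ 0])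
  case base
  then show ?case using U by (simp add: S.Sh_0 T.Sh_0 T.isoc_refl FOb_in)
next
  case (step1 i)
  from T.isoc_trans[OF F_Sh_1[OF S.Sh_in[OF U]] T.isoc_Sh[OF step1(2), of 1]]
  show ?case using U by (simp add: FOb_in add.commute)
next
  case (step2 i)
  \<comment> \<open>The downward step compares both objects after a shift by 1 and then undoes that
    shift.\<close>
  have "T.isoc (Sh T 1 (FOb F (Sh S (i - 1) U))) (Sh T i (FOb F U))"
    using T.isoc_trans[OF T.isoc_sym[OF F_Sh_1[OF S.Sh_in[OF U, of "i - 1"]]]] step2(2) U by simp
  from T.isoc_Sh[OF this, of "- 1"] show ?case
    using U by (simp add: FOb_in S.Sh_in T.Sh_0)
qed

text \<open>\<open>F\<close> respects every closure rule, the shift up to an isomorphism that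
  \<open>thick_isoc\<close> absorbs.\<close>

lemma F_thick:
  assumes "U \<in> thick S M" and M: "M \<in> Obj S" and P: "FOb F M \<in> thick T P"
  shows "FOb F U \<in> thick T P"
  using assms(1)
proof induction
  case base
  show ?case by (rule P)
next
  case (shift U n)
  show ?case
    using T.thick_isoc[OF thick.shift[OF shift.IH] T.isoc_sym[OF F_Sh[OF S.thick_Obj[OF shift.hyps M]]]] .
next
  case (ext U V W f g h)
  show ?case using thick.ext[OF FTri[OF ext.hyps(1)] ext.IH] .
next
  case (summand U V V')
  show ?case using thick.summand[OF summand.IH F_dsum[OF summand.hyps(2)]] .
qed

end

section \<open>Adjunctions, units and counits\<close>

locale adjunction =
  F: exact_functor S T F + G: exact_functor T S G + adjoint_pair S T F G \<eta> \<epsilon>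
  for S T F G \<eta> \<epsilon>
begin

lemma unit_arr: "U \<in> Obj S \<Longrightarrow> F.S.arr (\<eta> U) U (FOb G (FOb F U))"
  by (simp add: F.S.arr_def unit_in F.FOb_in G.FOb_in)

lemma counit_arr: "U \<in> Obj T \<Longrightarrow> F.T.arr (\<epsilon> U) (FOb F (FOb G U)) U"
  by (simp add: F.T.arr_def counit_in F.FOb_in G.FOb_in)

text \<open>By the triangle identities a morphism is recovered from its adjoint, so it is zero once
  the adjoint is.\<close>

lemma Hom_vanishes_adj:
  assumes U: "U \<in> Obj S" and V: "V \<in> Obj T"
  shows "Hom_vanishes T (FOb F U) V \<longleftrightarrow> Hom_vanishes S U (FOb G V)"
proof
  assume v: "Hom_vanishes T (FOb F U) V"
  show "Hom_vanishes S U (FOb G V)"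
  proof (rule F.S.Hom_vanishesI[OF U G.FOb_in[OF V]])
    fix u assume u: "F.S.arr u U (FOb G V)"
    note Fu = F.F_arr[OF u] and e = counit_arr[OF V] and n = unit_arr[OF U]
    have z: "\<epsilon> V \<cdot>\<^bsub>T\<^esub> FMor F u = Zer T (FOb F U) V"
      by (rule F.T.Hom_vanishesD[OF v F.T.arr_Cmp[OF Fu e]])
    have "u = (FMor G (\<epsilon> V) \<cdot>\<^bsub>S\<^esub> \<eta> (FOb G V)) \<cdot>\<^bsub>S\<^esub> u"
      using unit_counit[OF V] u by simp
    also have "\<dots> = FMor G (\<epsilon> V) \<cdot>\<^bsub>S\<^esub> \<eta> (FOb G V) \<cdot>\<^bsub>S\<^esub> u"
      by (rule F.S.arr_assoc[OF u unit_arr[OF G.FOb_in[OF V]] G.F_arr[OF e]])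
    also have "\<eta> (FOb G V) \<cdot>\<^bsub>S\<^esub> u = FMor G (FMor F u) \<cdot>\<^bsub>S\<^esub> \<eta> U"
      by (rule unit_natural[OF U G.FOb_in[OF V] F.S.arrD(3)[OF u]])
    also have "FMor G (\<epsilon> V) \<cdot>\<^bsub>S\<^esub> FMor G (FMor F u) \<cdot>\<^bsub>S\<^esub> \<eta> U = FMor G (\<epsilon> V \<cdot>\<^bsub>T\<^esub> FMor F u) \<cdot>\<^bsub>S\<^esub> \<eta> U"
      using F.S.arr_assoc[OF n G.F_arr[OF Fu] G.F_arr[OF e]] G.F_Cmp[OF Fu e] by simp
    also have "\<dots> = Zer S U (FOb G V)"
      unfolding z G.F_Zer[OF F.FOb_in[OF U] V] by (rule F.S.Zer_Cmp[OF n G.FOb_in[OF V]])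
    finally show "u = Zer S U (FOb G V)" .
  qed
next
  assume v: "Hom_vanishes S U (FOb G V)"
  show "Hom_vanishes T (FOb F U) V"
  proof (rule F.T.Hom_vanishesI[OF F.FOb_in[OF U] V])
    fix u assume u: "F.T.arr u (FOb F U) V"
    note Gu = G.F_arr[OF u] and e = counit_arr[OF F.FOb_in[OF U]] and n = unit_arr[OF U]
    have z: "FMor G u \<cdot>\<^bsub>S\<^esub> \<eta> U = Zer S U (FOb G V)"
      by (rule F.S.Hom_vanishesD[OF v F.S.arr_Cmp[OF n Gu]])
    have "u = u \<cdot>\<^bsub>T\<^esub> \<epsilon> (FOb F U) \<cdot>\<^bsub>T\<^esub> FMor F (\<eta> U)"
      using counit_unit[OF U] u by simp
    also have "\<dots> = (u \<cdot>\<^bsub>T\<^esub> \<epsilon> (FOb F U)) \<cdot>\<^bsub>T\<^esub> FMor F (\<eta> U)"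
      by (rule F.T.arr_assoc[OF F.F_arr[OF n] e u, symmetric])
    also have "u \<cdot>\<^bsub>T\<^esub> \<epsilon> (FOb F U) = \<epsilon> V \<cdot>\<^bsub>T\<^esub> FMor F (FMor G u)"
      by (rule counit_natural[OF F.FOb_in[OF U] V F.T.arrD(3)[OF u]])
    also have "(\<epsilon> V \<cdot>\<^bsub>T\<^esub> FMor F (FMor G u)) \<cdot>\<^bsub>T\<^esub> FMor F (\<eta> U) = \<epsilon> V \<cdot>\<^bsub>T\<^esub> FMor F (FMor G u \<cdot>\<^bsub>S\<^esub> \<eta> U)"
      using F.T.arr_assoc[OF F.F_arr[OF n] F.F_arr[OF Gu] counit_arr[OF V]] F.F_Cmp[OF n Gu] by simp
    also have "\<dots> = Zer T (FOb F U) V"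
      unfolding z F.F_Zer[OF U G.FOb_in[OF V]] by (rule F.T.Cmp_Zer[OF counit_arr[OF V] F.FOb_in[OF U]])
    finally show "u = Zer T (FOb F U) V" .
  qed
qed

lemma hv_adj:
  assumes U: "U \<in> Obj S" and V: "V \<in> Obj T"
  shows "F.T.hv k (FOb F U) V \<longleftrightarrow> F.S.hv k U (FOb G V)"
  using Hom_vanishes_adj[OF U F.T.Sh_in[OF V], of k]
    F.S.Hom_vanishes_isoc[OF F.S.isoc_refl[OF U] G.F_Sh[OF V, of k]] by simp

text \<open>Fullness lifts the counit at \<open>FOb F U\<close> to \<open>e\<close>; faithfulness
  gives one inverse law, naturality of the unit the other. The morphism \<open>e\<close> itself is
  kept for \<open>i_shriek_K\<close>.\<close>

lemma unit_iso:
  assumes ff: "fully_faithful S T F" and U: "U \<in> Obj S"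
  obtains e where "F.S.arr e (FOb G (FOb F U)) U" "e \<cdot>\<^bsub>S\<^esub> \<eta> U = Idm S U"
    "\<eta> U \<cdot>\<^bsub>S\<^esub> e = Idm S (FOb G (FOb F U))"
proof -
  note FU = F.FOb_in[OF U] and n = unit_arr[OF U]
  note GFU = G.FOb_in[OF FU]
  have b: "bij_betw (FMor F) (Hom S V W) (Hom T (FOb F V) (FOb F W))"
    if "V \<in> Obj S" "W \<in> Obj S" for V W
    using ff that by (simp add: fully_faithful_def)
  obtain e where "e \<in> Hom S (FOb G (FOb F U)) U" and Fe: "FMor F e = \<epsilon> (FOb F U)"
    using counit_in[OF FU] bij_betw_imp_surj_on[OF b[OF GFU U]] by (metis imageE)
  then have e: "F.S.arr e (FOb G (FOb F U)) U" using U GFU by (simp add: F.S.arr_def)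
  have "FMor F (e \<cdot>\<^bsub>S\<^esub> \<eta> U) = FMor F (Idm S U)"
    using F.F_Cmp[OF n e] counit_unit[OF U] Fe F.FMor_Idm[OF U] by simp
  then have 1: "e \<cdot>\<^bsub>S\<^esub> \<eta> U = Idm S U"
    using inj_onD[OF bij_betw_imp_inj_on[OF b[OF U U]]] F.S.arr_Cmp[OF n e] F.S.arr_Idm[OF U]
    by (simp add: F.S.arr_def)
  have "\<eta> U \<cdot>\<^bsub>S\<^esub> e = FMor G (FMor F e) \<cdot>\<^bsub>S\<^esub> \<eta> (FOb G (FOb F U))"
    by (rule unit_natural[OF GFU U F.S.arrD(3)[OF e]])
  also have "\<dots> = Idm S (FOb G (FOb F U))" using unit_counit[OF FU] Fe by simp
  finally show thesis using that e 1 by blast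
qed

lemma unit_isoc: "fully_faithful S T F \<Longrightarrow> U \<in> Obj S \<Longrightarrow> F.S.isoc U (FOb G (FOb F U))"
  by (erule (1) unit_iso) (rule F.S.isocI[OF unit_arr])

lemma counit_isoc:
  assumes ff: "fully_faithful T S G" and U: "U \<in> Obj T"
  shows "F.T.isoc (FOb F (FOb G U)) U"
proof -
  note GU = G.FOb_in[OF U] and n = counit_arr[OF U]
  note FGU = F.FOb_in[OF GU]
  have b: "bij_betw (FMor G) (Hom T V W) (Hom S (FOb G V) (FOb G W))"
    if "V \<in> Obj T" "W \<in> Obj T" for V W
    using ff that by (simp add: fully_faithful_def)
  obtain e where "e \<in> Hom T U (FOb F (FOb G U))" and Ge: "FMor G e = \<eta> (FOb G U)"
    using unit_in[OF GU] bij_betw_imp_surj_on[OF b[OF U FGU]] by (metis imageE)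
  then have e: "F.T.arr e U (FOb F (FOb G U))" using U FGU by (simp add: F.T.arr_def)
  have "FMor G (\<epsilon> U \<cdot>\<^bsub>T\<^esub> e) = FMor G (Idm T U)"
    using G.F_Cmp[OF e n] unit_counit[OF U] Ge G.FMor_Idm[OF U] by simp
  then have 1: "\<epsilon> U \<cdot>\<^bsub>T\<^esub> e = Idm T U"
    using inj_onD[OF bij_betw_imp_inj_on[OF b[OF U U]]] F.T.arr_Cmp[OF e n] F.T.arr_Idm[OF U]
    by (simp add: F.T.arr_def)
  have "e \<cdot>\<^bsub>T\<^esub> \<epsilon> U = \<epsilon> (FOb F (FOb G U)) \<cdot>\<^bsub>T\<^esub> FMor F (FMor G e)"
    by (rule counit_natural[OF U FGU F.T.arrD(3)[OF e]])
  also have "\<dots> = Idm T (FOb F (FOb G U))" using counit_unit[OF GU] Ge by simp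
  finally show ?thesis by (rule F.T.isocI[OF n e _ 1])
qed

end

section \<open>Recollements and gluing\<close>

context recollement
begin

sublocale PD: plain_triangulated D by unfold_locales
sublocale PX: plain_triangulated X by unfold_locales
sublocale PY: plain_triangulated Y by unfold_locales

sublocale iL: exact_functor D Y "i_pull \<R>"
  by (intro exact_functor.intro i_pull PD.plain_triangulated_axioms PY.plain_triangulated_axioms)
sublocale iM: exact_functor Y D "i_push \<R>"
  by (intro exact_functor.intro i_push PD.plain_triangulated_axioms PY.plain_triangulated_axioms)
sublocale iR: exact_functor D Y "i_shriek \<R>"
  by (intro exact_functor.intro i_shriek PD.plain_triangulated_axioms PY.plain_triangulated_axioms)
sublocale jL: exact_functor X D "j_shriek \<R>"
  by (intro exact_functor.intro j_shriek PD.plain_triangulated_axioms PX.plain_triangulated_axioms)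
sublocale jM: exact_functor D X "j_pull \<R>"
  by (intro exact_functor.intro j_pull PD.plain_triangulated_axioms PX.plain_triangulated_axioms)
sublocale jR: exact_functor X D "j_push \<R>"
  by (intro exact_functor.intro j_push PD.plain_triangulated_axioms PX.plain_triangulated_axioms)

sublocale iLM: adjunction D Y "i_pull \<R>" "i_push \<R>" "unit_i_pull_push \<R>" "counit_i_pull_push \<R>"
  by (intro adjunction.intro adj_i_pull_push iL.exact_functor_axioms iM.exact_functor_axioms)
sublocale iMR: adjunction Y D "i_push \<R>" "i_shriek \<R>" "unit_i_push_shriek \<R>" "counit_i_push_shriek \<R>"
  by (intro adjunction.intro adj_i_push_shriek iM.exact_functor_axioms iR.exact_functor_axioms)
sublocale jLM: adjunction X D "j_shriek \<R>" "j_pull \<R>" "unit_j_shriek_pull \<R>" "counit_j_shriek_pull \<R>"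
  by (intro adjunction.intro adj_j_shriek_pull jL.exact_functor_axioms jM.exact_functor_axioms)
sublocale jMR: adjunction D X "j_pull \<R>" "j_push \<R>" "unit_j_pull_push \<R>" "counit_j_pull_push \<R>"
  by (intro adjunction.intro adj_j_pull_push jM.exact_functor_axioms jR.exact_functor_axioms)

text \<open>Two adjunctions reduce endomorphisms of this object to morphisms from \<open>U\<close>
  into an object \<open>i_shriek j_push\<close>, which is zero by axiom.\<close>

lemma j_pull_i_push:
  assumes U: "U \<in> Obj Y" shows "is_zero X (FOb (j_pull \<R>) (FOb (i_push \<R>) U))"
proof -
  note o = iM.FOb_in[OF U]
  note jo = jM.FOb_in[OF o]
  have "Hom_vanishes Y U (FOb (i_shriek \<R>) (FOb (j_push \<R>) (FOb (j_pull \<R>) (FOb (i_push \<R>) U))))"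
    using PY.Hom_vanishes_to_zero[OF i_shriek_j_push[OF jo] U] .
  then show ?thesis
    using iMR.Hom_vanishes_adj[OF U jR.FOb_in[OF jo]] jMR.Hom_vanishes_adj[OF o jo]
    by (intro PX.Hom_vanishes_self[OF jo]) simp
qed

text \<open>The same reduction through the other two adjunctions ends at
  \<open>j_pull_i_push\<close>.\<close>

lemma i_pull_j_shriek:
  assumes U: "U \<in> Obj X" shows "is_zero Y (FOb (i_pull \<R>) (FOb (j_shriek \<R>) U))"
proof -
  note o = jL.FOb_in[OF U]
  note io = iL.FOb_in[OF o]
  have "Hom_vanishes X U (FOb (j_pull \<R>) (FOb (i_push \<R>) (FOb (i_pull \<R>) (FOb (j_shriek \<R>) U))))"
    using PX.Hom_vanishes_to_zero[OF j_pull_i_push[OF io] U] .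
  then show ?thesis
    using jLM.Hom_vanishes_adj[OF U iM.FOb_in[OF io]] iLM.Hom_vanishes_adj[OF o io]
    by (intro PY.Hom_vanishes_self[OF io]) simp
qed

text \<open>In the triangle \<open>triangle_i_j\<close> of \<open>j_shriek U\<close>, the functor
  \<open>i_pull\<close> kills the middle term; full faithfulness of \<open>j_shriek\<close> and
  \<open>i_push\<close> simplifies the outer terms.\<close>

lemma i_pull_j_push_isoc:
  assumes U: "U \<in> Obj X"
  shows "PY.isoc (FOb (i_pull \<R>) (FOb (j_push \<R>) U)) (Sh Y 1 (FOb (i_shriek \<R>) (FOb (j_shriek \<R>) U)))"
proof -
  note o = jL.FOb_in[OF U]
  obtain h where t: "(FOb (i_push \<R>) (FOb (i_shriek \<R>) (FOb (j_shriek \<R>) U)), FOb (j_shriek \<R>) U,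
      FOb (j_push \<R>) (FOb (j_pull \<R>) (FOb (j_shriek \<R>) U)), counit_i_push_shriek \<R> (FOb (j_shriek \<R>) U),
      unit_j_pull_push \<R> (FOb (j_shriek \<R>) U), h) \<in> Tri D"
    using triangle_i_j[OF o] by blast
  have "PY.isoc (FOb (i_pull \<R>) (FOb (j_push \<R>) U))
      (FOb (i_pull \<R>) (FOb (j_push \<R>) (FOb (j_pull \<R>) (FOb (j_shriek \<R>) U))))"
    by (rule iL.F_isoc[OF jR.F_isoc[OF jLM.unit_isoc[OF ff_j_shriek U]]])
  moreover have "PY.isoc \<dots> (Sh Y 1 (FOb (i_pull \<R>) (FOb (i_push \<R>) (FOb (i_shriek \<R>) (FOb (j_shriek \<R>) U)))))"
    by (rule PY.Tri_second_zero[OF iL.FTri[OF t] i_pull_j_shriek[OF U]])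
  moreover have "PY.isoc \<dots> (Sh Y 1 (FOb (i_shriek \<R>) (FOb (j_shriek \<R>) U)))"
    by (rule PY.isoc_Sh[OF iLM.counit_isoc[OF ff_i_push iR.FOb_in[OF o]]])
  ultimately show ?thesis by (blast intro: PY.isoc_trans)
qed

end

text \<open>\<open>P\<close> and \<open>Q\<close> are the tilting objects \<open>X\<close> and \<open>Y\<close> of the paper.\<close>

locale gluing = recollement +
  fixes P Q V V' b b' b'' K k k' Z
  assumes P: "tilting X P" and Q: "tilting Y Q"
    and V: "V \<in> co_ge Y Q 1" and V': "V' \<in> co_le Y Q 0"
    and truncation: "(V, FOb (i_shriek \<R>) (FOb (j_shriek \<R>) P), V', b, b', b'') \<in> Tri Y"
    and K: "(FOb (i_push \<R>) V, FOb (j_shriek \<R>) P, K,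
         counit_i_push_shriek \<R> (FOb (j_shriek \<R>) P) \<cdot>\<^bsub>D\<^esub> FMor (i_push \<R>) b, k, k') \<in> Tri D"
    and Z: "is_dsum D Z (FOb (i_push \<R>) Q) K"
begin

abbreviation A where "A \<equiv> Sh Y 1 V"

abbreviation W where "W \<equiv> FOb (i_pull \<R>) (FOb (j_push \<R>) P)"

lemma P_obj: "P \<in> Obj X" and hv_P_P: "n \<noteq> 0 \<Longrightarrow> PX.hv n P P" and thick_P: "thick X P = Obj X"
  using P neq_iff[of n 0] unfolding tilting_def silting_def by blast+

lemma Q_obj: "Q \<in> Obj Y" and hv_Q_Q: "n \<noteq> 0 \<Longrightarrow> PY.hv n Q Q" and thick_Q: "thick Y Q = Obj Y"
  using Q neq_iff[of n 0] unfolding tilting_def silting_def by blast+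

text \<open>The shift by -1 contained in \<open>co_ge Y Q 1\<close> cancels against the shift in
  \<open>A\<close>.\<close>

lemma A_closure: "A \<in> add_ext_closure Y {Sh Y i Q |i. i \<le> 0}"
proof -
  obtain U where U: "U \<in> add_ext_closure Y {Sh Y i Q |i. i \<le> 0}" "V = Sh Y (- 1) U"
    using V by (auto simp: co_ge_def)
  have "U \<in> Obj Y" by (rule PY.add_ext_closure_Obj[OF U(1)]) (use Y.Sh_in Q_obj in blast)
  with U show ?thesis by (simp add: Y.Sh_0)
qed

lemma V'_closure: "V' \<in> add_ext_closure Y {Sh Y i Q |i. i \<ge> 0}"
proof -
  obtain U where U: "U \<in> add_ext_closure Y {Sh Y i Q |i. i \<ge> 0}" "V' = Sh Y 0 U"
    using V' by (auto simp: co_le_def)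
  have "U \<in> Obj Y" by (rule PY.add_ext_closure_Obj[OF U(1)]) (use Y.Sh_in Q_obj in blast)
  with U show ?thesis by (simp add: Y.Sh_0)
qed

lemma Y_objs: "V \<in> Obj Y" "V' \<in> Obj Y" "A \<in> Obj Y" "W \<in> Obj Y"
  using PY.Tri_arr(1,3)[OF truncation] Y.Sh_in iL.FOb_in jR.FOb_in P_obj by blast+

lemma K_obj: "K \<in> Obj D"
  by (rule PD.Tri_arr(3)[OF K])

lemma hv_A_right:
  assumes "U \<in> Obj Y" and "\<And>i. i \<le> 0 \<Longrightarrow> PY.hv (n + i) U Q"
  shows "PY.hv n U A"
  using A_closure assms(1)
  by (rule PY.hv_add_ext_closure_right) (use assms Q_obj in \<open>auto simp: PY.hv_Sh_right\<close>)

lemma hv_A_left: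
  assumes "U \<in> Obj Y" and "\<And>i. i \<le> 0 \<Longrightarrow> PY.hv (n - i) Q U"
  shows "PY.hv n A U"
  using A_closure assms(1)
  by (rule PY.hv_add_ext_closure_left) (use assms Q_obj in \<open>auto simp: PY.hv_Sh_left\<close>)

lemma hv_V'_right:
  assumes "U \<in> Obj Y" and "\<And>i. i \<ge> 0 \<Longrightarrow> PY.hv (n + i) U Q"
  shows "PY.hv n U V'"
  using V'_closure assms(1)
  by (rule PY.hv_add_ext_closure_right) (use assms Q_obj in \<open>auto simp: PY.hv_Sh_right\<close>)

lemma hv_V'_left:
  assumes "U \<in> Obj Y" and "\<And>i. i \<ge> 0 \<Longrightarrow> PY.hv (n - i) Q U"
  shows "PY.hv n V' U"
  using V'_closure assms(1)
  by (rule PY.hv_add_ext_closure_left) (use assms Q_obj in \<open>auto simp: PY.hv_Sh_left\<close>)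

section \<open>The images of \<open>K\<close> under \<open>i_pull\<close>, \<open>j_pull\<close> and
  \<open>i_shriek\<close>\<close>

lemma i_pull_K: "PY.isoc (FOb (i_pull \<R>) K) A"
  using PY.isoc_trans[OF PY.Tri_second_zero[OF iL.FTri[OF K] i_pull_j_shriek[OF P_obj]]
      PY.isoc_Sh[OF iLM.counit_isoc[OF ff_i_push Y_objs(1)]]] .

text \<open>Here the first term of the triangle defining \<open>K\<close> is killed, by
  \<open>j_pull_i_push\<close>.\<close>

lemma j_pull_K: "PX.isoc (FOb (j_pull \<R>) K) P"
  using PX.isoc_sym[OF PX.isoc_trans[OF jLM.unit_isoc[OF ff_j_shriek P_obj]
      PX.Tri_first_zero[OF jM.FTri[OF K] j_pull_i_push[OF Y_objs(1)]]]] .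

text \<open>Under the unit isomorphism from \<open>V\<close> to \<open>i_shriek i_push V\<close>,
  the first morphism of the image triangle becomes \<open>b\<close>. So \<open>i_shriek K\<close>
  and \<open>V'\<close> are cones of the same morphism.\<close>

lemma i_shriek_K: "PY.isoc (FOb (i_shriek \<R>) K) V'"
proof -
  let ?E = "FOb (i_shriek \<R>) (FOb (j_shriek \<R>) P)" and ?\<eta> = "unit_i_push_shriek \<R>"
  let ?\<epsilon> = "counit_i_push_shriek \<R> (FOb (j_shriek \<R>) P)"
  let ?f = "FMor (i_shriek \<R>) (?\<epsilon> \<cdot>\<^bsub>D\<^esub> FMor (i_push \<R>) b)"
  note b = PY.Tri_arr(4)[OF truncation] and n = iMR.unit_arr[OF Y_objs(1)]
  note e = iMR.counit_arr[OF jL.FOb_in[OF P_obj]]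
  note iE = iR.FOb_in[OF jL.FOb_in[OF P_obj]]
  obtain \<eta>' where n': "PY.arr \<eta>' (FOb (i_shriek \<R>) (FOb (i_push \<R>) V)) V" "\<eta>' \<cdot>\<^bsub>Y\<^esub> ?\<eta> V = Idm Y V"
    "?\<eta> V \<cdot>\<^bsub>Y\<^esub> \<eta>' = Idm Y (FOb (i_shriek \<R>) (FOb (i_push \<R>) V))"
    using iMR.unit_iso[OF ff_i_push Y_objs(1)] .
  have "?f \<cdot>\<^bsub>Y\<^esub> ?\<eta> V = FMor (i_shriek \<R>) ?\<epsilon> \<cdot>\<^bsub>Y\<^esub> FMor (i_shriek \<R>) (FMor (i_push \<R>) b) \<cdot>\<^bsub>Y\<^esub> ?\<eta> V"
    using iR.F_Cmp[OF iM.F_arr[OF b] e] PY.arr_assoc[OF n iR.F_arr[OF iM.F_arr[OF b]] iR.F_arr[OF e]] by simp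
  \<comment> \<open>Naturality moves the unit past \<open>b\<close>, where the triangle identity at
    \<open>j_shriek P\<close> removes it.\<close>
  also have "\<dots> = FMor (i_shriek \<R>) ?\<epsilon> \<cdot>\<^bsub>Y\<^esub> ?\<eta> ?E \<cdot>\<^bsub>Y\<^esub> b"
    using iMR.unit_natural[OF Y_objs(1) iE PY.arrD(3)[OF b]] by simp
  also have "\<dots> = b"
    using PY.arr_assoc[OF b iMR.unit_arr[OF iE] iR.F_arr[OF e]] iMR.unit_counit[OF jL.FOb_in[OF P_obj]] b by simp
  finally have f: "?f \<cdot>\<^bsub>Y\<^esub> ?\<eta> V = b" .
  from PY.Tri_replace_first[OF iR.FTri[OF K] n n'] show ?thesis
    unfolding f using PY.Tri_cone_unique[OF _ truncation] by blast
qed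

text \<open>The third term is isomorphic to \<open>W\<close> by
  \<open>i_pull_j_push_isoc\<close>.\<close>

lemma W_triangle: obtains f g h where "(V', A, Sh Y 1 (FOb (i_shriek \<R>) (FOb (j_shriek \<R>) P)), f, g, h) \<in> Tri Y"
  using PY.Tri_rot[OF PY.Tri_rot[OF truncation]] by blast

section \<open>Vanishing that holds without (a), (b), (c)\<close>

lemma hv_Q_V': "n > 0 \<Longrightarrow> PY.hv n Q V'"
  by (rule hv_V'_right[OF Q_obj]) (simp add: hv_Q_Q)

lemma hv_A_Q: "n > 0 \<Longrightarrow> PY.hv n A Q"
  by (rule hv_A_left[OF Q_obj]) (simp add: hv_Q_Q)

lemma hv_A_V': "n > 0 \<Longrightarrow> PY.hv n A V'"
  by (rule hv_A_left[OF Y_objs(2)]) (simp add: hv_Q_V')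

text \<open>Unlike the three lemmas before, this and \<open>hv_V'_Q\<close> rest on the vanishing of
  \<open>Hom(Q, Q[n])\<close> for negative \<open>n\<close>, that is, on \<open>Q\<close> being
  tilting.\<close>

lemma hv_Q_A: "n < 0 \<Longrightarrow> PY.hv n Q A"
  by (rule hv_A_right[OF Q_obj]) (simp add: hv_Q_Q)

lemma hv_V'_Q: "n < 0 \<Longrightarrow> PY.hv n V' Q"
  by (rule hv_V'_left[OF Q_obj]) (simp add: hv_Q_Q)

text \<open>The first two conditions on each side correspond separately; the third ones are
  equivalent once the first two hold.\<close>

lemma conditions_iff:
  "(\<forall>n < -1. PY.hv n Q W) \<and> (\<forall>n<0. PY.hv n W Q) \<and> (\<forall>n < -1. PY.hv n W W) \<longleftrightarrow>
   (\<forall>n<0. PY.hv n Q V') \<and> (\<forall>n<0. PY.hv n A Q) \<and> (\<forall>n<0. PY.hv n A V')"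
proof -
  define W1 where "W1 = Sh Y 1 (FOb (i_shriek \<R>) (FOb (j_shriek \<R>) P))"
  obtain f g h where t: "(V', A, W1, f, g, h) \<in> Tri Y"
    unfolding W1_def by (rule W_triangle)
  note W1 = PY.Tri_arr(3)[OF t] and r = PY.hv_Tri_right[OF t] and l = PY.hv_Tri_left[OF t]
  have i: "PY.isoc W W1" unfolding W1_def by (rule i_pull_j_push_isoc[OF P_obj])
  note iQ = PY.isoc_refl[OF Q_obj]
  \<comment> \<open>\<open>Hom(Q, V'[n])\<close> corresponds to \<open>Hom(Q, W1[n - 1])\<close>,
    which accounts for the bound -1.\<close>
  have a: "(\<forall>n < -1. PY.hv n Q W1) \<longleftrightarrow> (\<forall>n<0. PY.hv n Q V')"
  proof (intro iffI allI impI)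
    fix n :: int assume "\<forall>n < -1. PY.hv n Q W1" "n < 0"
    then show "PY.hv n Q V'" using r(3)[OF Q_obj, of n] hv_Q_A[of n] by simp
  next
    fix n :: int assume "\<forall>n<0. PY.hv n Q V'" "n < -1"
    then show "PY.hv n Q W1" using r(2)[OF Q_obj, of n] hv_Q_A[of n] by simp
  qed
  \<comment> \<open>In the contravariant sequence \<open>A\<close> and \<open>W1\<close> occur in
    the same degree, so the bound stays 0.\<close>
  have b: "(\<forall>n<0. PY.hv n W1 Q) \<longleftrightarrow> (\<forall>n<0. PY.hv n A Q)"
  proof (intro iffI allI impI)
    fix n :: int assume "\<forall>n<0. PY.hv n W1 Q" "n < 0"
    then show "PY.hv n A Q" using l(1)[OF Q_obj, of n] hv_V'_Q[of n] by simp
  next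
    fix n :: int assume "\<forall>n<0. PY.hv n A Q" "n < 0"
    then show "PY.hv n W1 Q" using l(2)[OF Q_obj, of n] hv_V'_Q[of "n - 1"] by simp
  qed
  have c: "(\<forall>n < -1. PY.hv n W1 W1) \<longleftrightarrow> (\<forall>n<0. PY.hv n A V')"
    if 1: "\<forall>n<0. PY.hv n Q V'" and 2: "\<forall>n<0. PY.hv n W1 Q"
  proof -
    \<comment> \<open>\<open>A\<close> is built from shifts \<open>Q[i]\<close> with
      \<open>i \<le> 0\<close>, which only lower the degree, so the vanishing passes from
      \<open>Q\<close> to \<open>A\<close>. The next claim treats \<open>V'\<close> in the source
      likewise.\<close>
    have W1A: "PY.hv n W1 A" if "n < 0" for n
      by (rule hv_A_right[OF W1]) (use 2 that in simp)
    have V'V': "PY.hv n V' V'" if "n < 0" for n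
      by (rule hv_V'_left[OF Y_objs(2)]) (use 1 that in simp)
    show ?thesis
    proof (intro iffI allI impI)
      fix n :: int assume c: "\<forall>n < -1. PY.hv n W1 W1" and n: "n < 0"
      \<comment> \<open>\<open>Hom(W1, V'[n])\<close> mediates between the two sides: the triangle
        is used once in the target and once in the source.\<close>
      have "PY.hv n W1 V'" using r(3)[OF W1, of n] W1A[OF n] c n by simp
      then show "PY.hv n A V'" using l(1)[OF Y_objs(2), of n] V'V'[OF n] by simp
    next
      fix n :: int assume c: "\<forall>n<0. PY.hv n A V'" and n: "n < -1"
      have "PY.hv (n + 1) W1 V'" using l(2)[OF Y_objs(2), of "n + 1"] V'V'[of n] c n by simp
      then show "PY.hv n W1 W1" using r(2)[OF W1, of n] W1A[of n] n by simp
    qed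
  qed
  show ?thesis
    unfolding PY.hv_isoc[OF iQ i] PY.hv_isoc[OF i iQ] PY.hv_isoc[OF i i] using a b c by blast
qed

section \<open>Shifted endomorphisms of \<open>Z\<close> and generation\<close>

lemma hv_Z_iff:
  "PD.hv n Z Z \<longleftrightarrow> PD.hv n (FOb (i_push \<R>) Q) (FOb (i_push \<R>) Q) \<and> PD.hv n (FOb (i_push \<R>) Q) K \<and>
     PD.hv n K (FOb (i_push \<R>) Q) \<and> PD.hv n K K"
  using PD.hv_dsum_left[OF Z] PD.hv_dsum_right[OF Z] PD.is_dsum_Obj[OF Z] by blast

lemma hv_iQ_iQ: "n \<noteq> 0 \<Longrightarrow> PD.hv n (FOb (i_push \<R>) Q) (FOb (i_push \<R>) Q)"
  using iMR.hv_adj[OF Q_obj iM.FOb_in[OF Q_obj]]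
    PY.hv_isoc[OF PY.isoc_refl[OF Q_obj] iMR.unit_isoc[OF ff_i_push Q_obj]] hv_Q_Q by simp

lemma hv_iQ_K: "PD.hv n (FOb (i_push \<R>) Q) K \<longleftrightarrow> PY.hv n Q V'"
  using iMR.hv_adj[OF Q_obj K_obj] PY.hv_isoc[OF PY.isoc_refl[OF Q_obj] i_shriek_K] by simp

lemma hv_K_iQ: "PD.hv n K (FOb (i_push \<R>) Q) \<longleftrightarrow> PY.hv n A Q"
  using iLM.hv_adj[OF K_obj Q_obj] PY.hv_isoc[OF i_pull_K PY.isoc_refl[OF Q_obj]] by simp

text \<open>In \<open>triangle_i_j\<close> for \<open>K\<close>, the term
  \<open>j_push j_pull K\<close> contributes \<open>Hom(P, P[n])\<close>, which vanishes for nonzero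
  \<open>n\<close>; what remains is \<open>Hom(A, V'[n])\<close>.\<close>

lemma hv_K_K:
  shows "n > 0 \<Longrightarrow> PD.hv n K K" and "n < 0 \<Longrightarrow> PD.hv n K K \<longleftrightarrow> PY.hv n A V'"
proof -
  obtain h where t: "(FOb (i_push \<R>) (FOb (i_shriek \<R>) K), K, FOb (j_push \<R>) (FOb (j_pull \<R>) K),
       counit_i_push_shriek \<R> K, unit_j_pull_push \<R> K, h) \<in> Tri D"
    using triangle_i_j[OF K_obj] by blast
  have j: "PD.hv n K (FOb (j_push \<R>) (FOb (j_pull \<R>) K))" if "n \<noteq> 0" for n
    using jMR.hv_adj[OF K_obj jM.FOb_in[OF K_obj]] PX.hv_isoc[OF j_pull_K j_pull_K] hv_P_P[OF that] by simp
  have i: "PD.hv n K (FOb (i_push \<R>) (FOb (i_shriek \<R>) K)) \<longleftrightarrow> PY.hv n A V'" for n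
    using iLM.hv_adj[OF K_obj iR.FOb_in[OF K_obj]] PY.hv_isoc[OF i_pull_K i_shriek_K] by simp
  note r = PD.hv_Tri_right[OF t K_obj]
  show "PD.hv n K K" if "n > 0"
    using r(1) i j[of n] hv_A_V' that by simp
  \<comment> \<open>The forward direction uses the vanishing in degree \<open>n - 1\<close>, which
    is nonzero because \<open>n < 0\<close>.\<close>
  show "PD.hv n K K \<longleftrightarrow> PY.hv n A V'" if "n < 0"
    using r(1)[of n] r(3)[of n] i[of n] j[of n] j[of "n - 1"] that by auto
qed

text \<open>From \<open>i_push Q\<close> one gets all of the image of \<open>i_push\<close>, then
  \<open>j_shriek P\<close> and the image of \<open>j_shriek\<close>; the triangles
  \<open>triangle_j_i\<close> give every object.\<close>

lemma thick_Z: "thick D Z = Obj D"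
proof
  show "thick D Z \<subseteq> Obj D" using PD.thick_Obj PD.is_dsum_Obj(1)[OF Z] by blast
  have iQ: "FOb (i_push \<R>) Q \<in> thick D Z" and K': "K \<in> thick D Z"
    using thick.summand[OF thick.base Z] thick.summand[OF thick.base PD.is_dsum_comm[OF Z]] by blast+
  have i: "FOb (i_push \<R>) U \<in> thick D Z" if "U \<in> Obj Y" for U
    using iM.F_thick[OF _ Q_obj iQ] that thick_Q by blast
  \<comment> \<open>\<open>j_shriek P\<close> is the middle term of the triangle defining
    \<open>K\<close>, hence an extension of objects already reached.\<close>
  have "FOb (j_shriek \<R>) P \<in> thick D Z"
    by (rule thick.ext[OF K i[OF Y_objs(1)] K'])
  then have j: "FOb (j_shriek \<R>) U \<in> thick D Z" if "U \<in> Obj X" for U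
    using jL.F_thick[OF _ P_obj] that thick_P by blast
  show "Obj D \<subseteq> thick D Z"
  proof
    fix U assume U: "U \<in> Obj D"
    obtain h where "(FOb (j_shriek \<R>) (FOb (j_pull \<R>) U), U, FOb (i_push \<R>) (FOb (i_pull \<R>) U),
           counit_j_shriek_pull \<R> U, unit_i_pull_push \<R> U, h) \<in> Tri D"
      using triangle_j_i[OF U] by blast
    from thick.ext[OF this j[OF jM.FOb_in[OF U]] i[OF iL.FOb_in[OF U]]] show "U \<in> thick D Z" .
  qed
qed

text \<open>All four blocks of \<open>hv_Z_iff\<close> vanish in positive degrees, so being tilting
  is a question about negative degrees only.\<close>

lemma silting_Z: "silting D Z"
  unfolding silting_def using PD.is_dsum_Obj(1)[OF Z] thick_Z hv_Z_iff hv_iQ_iQ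
    hv_iQ_K hv_Q_V' hv_K_iQ hv_A_Q hv_K_K(1) by simp

lemma tilting_Z_iff:
  "tilting D Z \<longleftrightarrow>
    (\<forall>n < -1. PY.hv n Q W) \<and> (\<forall>n<0. PY.hv n W Q) \<and> (\<forall>n < -1. PY.hv n W W)"
  unfolding conditions_iff tilting_def using silting_Z hv_Z_iff hv_iQ_iQ hv_iQ_K hv_K_iQ hv_K_K(2)
  by auto

end

theorem theorem4p5:
  fixes \<K> :: "('k, 'kx) ring_scheme"
    and R :: "('k, 'r, 'rx) module_scheme"
    and B :: "('k, 'b, 'bx) module_scheme"
    and C :: "('k, 'c, 'cx) module_scheme"
    and \<R> :: "(('r, 'r list) cpx, ('r, 'r list) der_mor,
               ('c, 'c list) cpx, ('c, 'c list) der_mor,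
               ('b, 'b list) cpx, ('b, 'b list) der_mor) recollement_data"
    and X :: "('c, 'c list) cpx"
    and Y :: "('b, 'b list) cpx"
    and Z :: "('r, 'r list) cpx"
  assumes "field \<K>"
    and "fd_algebra \<K> R" and "fd_algebra \<K> B" and "fd_algebra \<K> C"
    and "finite_global_dimension R"
    and "recollement (Db R) (Db C) (Db B) \<R>"
    and "tilting (Db C) X" and "tilting (Db B) Y"
    and "is_glued (Db R) (Db C) (Db B) \<R> X Y Z"
  shows "tilting (Db R) Z \<longleftrightarrow>
    (let W = FOb (i_pull \<R>) (FOb (j_push \<R>) X) in
      (\<forall>k < -1. Hom_vanishes (Db B) Y (Sh (Db B) k W)) \<and>
      (\<forall>k < 0. Hom_vanishes (Db B) W (Sh (Db B) k Y)) \<and>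
      (\<forall>k < -1. Hom_vanishes (Db B) W (Sh (Db B) k W)))"
proof -
  \<comment> \<open>The truncation and cone chosen in \<open>is_glued\<close> become parameters of
    \<open>gluing\<close>; the equivalence holds for every choice.\<close>
  obtain V V' b b' b'' K k k' where g: "V \<in> co_ge (Db B) Y 1" "V' \<in> co_le (Db B) Y 0"
    "(V, FOb (i_shriek \<R>) (FOb (j_shriek \<R>) X), V', b, b', b'') \<in> Tri (Db B)"
    "(FOb (i_push \<R>) V, FOb (j_shriek \<R>) X, K,
      counit_i_push_shriek \<R> (FOb (j_shriek \<R>) X) \<cdot>\<^bsub>Db R\<^esub> FMor (i_push \<R>) b, k, k') \<in> Tri (Db R)"
    "is_dsum (Db R) Z (FOb (i_push \<R>) Y) K"
    using assms(9) unfolding is_glued_def by blast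
  interpret gluing "Db R" "Db C" "Db B" \<R> X Y V V' b b' b'' K k k' Z
    by (intro gluing.intro gluing_axioms.intro assms(6-8) g)
  show ?thesis unfolding Let_def by (rule tilting_Z_iff)
qed

end
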